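(* Let $\mathcal{C}$ be a colored $(k+1)$-configuration with $n$ points and $n$ lines. Then there exists a connected $k$-dimensional simplicial complex $X=X(\mathcal{C})$ with $\pi_1(X)\cong\mathbb{Z}^k$ such that: (1) $X$ has exactly $n$ vertices. (2) $X$ contains a copy of $\mathcal{C}$ consisting of $n$ facets of $X$, and a copy of the dual configuration $\mathcal{C}^*$ consisting of $n$ other facets of $X$; that is, there are a bijection $\alpha$ from $P(\mathcal{C})$ to the vertex set of $X$ and a bijection from $L(\mathcal{C})$ to a set $\mathcal{F}_1$ of $n$ facets of $X$ such that a point $p$ is incident with a line $l$ iff $\alpha(p)$ lies in the facet corresponding to $l$, and likewise a bijection from $L(\mathcal{C})$ to the vertex set of $X$ and a bijection from $P(\mathcal{C})$ to a set $\mathcal{F}_2$ of $n$ facets of $X$, disjoint from $\mathcal{F}_1$, respecting incidence in the same way. Moreover $\mathcal{F}_1\cup\mathcal{F}_2$ is the set of all facets of $X$, and every face of $X$ is contained in a facet. (3) If a group $G$ acts on $\mathcal{C}$ via an action $\rho$, then $G$ acts on $X$ (by simplicial automorphisms) via $\rho_P$, the induced action on the points of $\mathcal{C}$, transported to the vertices of $X$ by $\alpha$. (4) If $\mathcal{C}$ is moreover a projective plane, then $X$ is 2-neighborly, i.e. every pair of distinct vertices of $X$ forms an edge.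
   Context: A $k$-configuration consists of finite sets $P$ (points), $L$ (lines) and an incidence relation $R\subseteq P\times L$ such that: (i) there do not exist distinct $p_1,p_2\in P$ and distinct $l_1,l_2\in L$ with $(p_i,l_j)\in R$ for all $i,j\in\{1,2\}$; (ii) each point is incident with exactly $k$ lines; (iii) each line is incident with exactly $k$ points. Its incidence graph $G(\mathcal{C})$ has vertex set $P\sqcup L$ and an edge $\{p,l\}$ for each $(p,l)\in R$; $\mathcal{C}$ is connected if $G(\mathcal{C})$ is. A $k$-edge coloring of a graph is a map $\chi\colon E\to[k]=\{1,\dots,k\}$ assigning distinct colors to distinct edges sharing a vertex. For a $k$-regular bipartite graph with a $k$-edge coloring and a color $c$, $\phi_c(v)$ is the unique neighbor $w$ of $v$ with $\chi(vw)=c$. The coloring has the 6-cycle property if for every vertex $v$ and all distinct colors $a,b,c$, $(\phi_c\circ\phi_b\circ\phi_a\circ\phi_c\circ\phi_b\circ\phi_a)(v)=v$. A colored $k$-configuration is a connected $k$-configuration together with a $k$-edge coloring of $G(\mathcal{C})$ with the 6-cycle property. The dual $\mathcal{C}^*$ has as points the lines of $\mathcal{C}$, as lines the points of $\mathcal{C}$, with $(l,p)$ incident in $\mathcal{C}^*$ iff $(p,l)$ is incident in $\mathcal{C}$, with the same color. A homomorphism $\psi\colon\mathcal{C}\to\mathcal{D}$ of colored $k$-configurations consists of maps $\psi_P\colon P(\mathcal{C})\to P(\mathcal{D})$, $\psi_L\colon L(\mathcal{C})\to L(\mathcal{D})$, $\psi_\chi\colon[k]\to[k]$ such that incidences map to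 incidences and the color of $(\psi_P(p),\psi_L(l))$ equals $\psi_\chi$ of the color of $(p,l)$. An action of a group $G$ on $\mathcal{C}$ is a group homomorphism $\rho\colon G\to\mathrm{Aut}(\mathcal{C})$; $\rho_P$ denotes the induced action on points. A projective plane is an incidence structure in which any two distinct points lie on a unique common line, any two distinct lines share a unique common point, and there exist four points no three of which are on a common line.
   Formalization: The formal theorem assumes k ≥ 2; for k = 1 (e.g. the triangle: X would be a graph with 3 vertices and 6 edges) and for k = 0 (one vertex, two distinct facets) no such X exists, so the claim as stated always fails there. *)

theory Defs
  imports "HOL-Analysis.Analysis" "HOL-Algebra.Product_Groups" "HOL-Algebra.Elementary_Groups"
begin

section \<open>Graphs and edge colorings\<close>

text \<open>A simple graph is given by its vertex set \<open>V\<close> and its set \<open>E\<close> of two-element edges. The empty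
  graph is not regarded as connected.\<close>

definition graph_connected :: "'v set \<Rightarrow> 'v set set \<Rightarrow> bool" where
  "graph_connected V E \<longleftrightarrow>
     V \<noteq> {} \<and> (\<forall>u\<in>V. \<forall>v\<in>V. (u, v) \<in> {(x, y). {x, y} \<in> E}\<^sup>*)"

definition edge_coloring :: "nat \<Rightarrow> 'v set set \<Rightarrow> ('v set \<Rightarrow> nat) \<Rightarrow> bool" where
  "edge_coloring k E \<kappa> \<longleftrightarrow>
     \<kappa> ` E \<subseteq> {1..k} \<and> (\<forall>e\<in>E. \<forall>f\<in>E. e \<noteq> f \<and> e \<inter> f \<noteq> {} \<longrightarrow> \<kappa> e \<noteq> \<kappa> f)"

definition color_neighbor :: "'v set set \<Rightarrow> ('v set \<Rightarrow> nat) \<Rightarrow> nat \<Rightarrow> 'v \<Rightarrow> 'v" where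
  "color_neighbor E \<kappa> c v = (THE w. {v, w} \<in> E \<and> \<kappa> {v, w} = c)"

definition six_cycle_property :: "nat \<Rightarrow> 'v set \<Rightarrow> 'v set set \<Rightarrow> ('v set \<Rightarrow> nat) \<Rightarrow> bool" where
  "six_cycle_property k V E \<kappa> \<longleftrightarrow>
     (\<forall>v\<in>V. \<forall>a\<in>{1..k}. \<forall>b\<in>{1..k}. \<forall>c\<in>{1..k}. a \<noteq> b \<and> a \<noteq> c \<and> b \<noteq> c \<longrightarrow>
        (let \<phi> = color_neighbor E \<kappa> in (\<phi> c \<circ> \<phi> b \<circ> \<phi> a \<circ> \<phi> c \<circ> \<phi> b \<circ> \<phi> a) v = v))"


section \<open>Colored configurations\<close>

text \<open>The coloring is a function on sets of vertices of the incidence graph; only its values on edges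
  are relevant.\<close>

record ('p, 'l) config =
  points :: "'p set"
  lines :: "'l set"
  inc :: "('p \<times> 'l) set"
  col :: "('p + 'l) set \<Rightarrow> nat"

definition inc_verts :: "('p, 'l) config \<Rightarrow> ('p + 'l) set" where
  "inc_verts C = points C <+> lines C"

definition inc_edges :: "('p, 'l) config \<Rightarrow> ('p + 'l) set set" where
  "inc_edges C = {{Inl p, Inr l} | p l. (p, l) \<in> inc C}"

definition configuration :: "nat \<Rightarrow> ('p, 'l) config \<Rightarrow> bool" where
  "configuration k C \<longleftrightarrow>
     finite (points C) \<and> finite (lines C) \<and> inc C \<subseteq> points C \<times> lines C \<and>
     \<not> (\<exists>p\<^sub>1\<in>points C. \<exists>p\<^sub>2\<in>points C. \<exists>l\<^sub>1\<in>lines C. \<exists>l\<^sub>2\<in>lines C.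
          p\<^sub>1 \<noteq> p\<^sub>2 \<and> l\<^sub>1 \<noteq> l\<^sub>2 \<and>
          (p\<^sub>1, l\<^sub>1) \<in> inc C \<and> (p\<^sub>1, l\<^sub>2) \<in> inc C \<and> (p\<^sub>2, l\<^sub>1) \<in> inc C \<and> (p\<^sub>2, l\<^sub>2) \<in> inc C) \<and>
     (\<forall>p\<in>points C. card {l \<in> lines C. (p, l) \<in> inc C} = k) \<and>
     (\<forall>l\<in>lines C. card {p \<in> points C. (p, l) \<in> inc C} = k)"

definition colored_configuration :: "nat \<Rightarrow> ('p, 'l) config \<Rightarrow> bool" where
  "colored_configuration k C \<longleftrightarrow>
     configuration k C \<and>
     graph_connected (inc_verts C) (inc_edges C) \<and>
     edge_coloring k (inc_edges C) (col C) \<and>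
     six_cycle_property k (inc_verts C) (inc_edges C) (col C)"

definition dual :: "('p, 'l) config \<Rightarrow> ('l, 'p) config" where
  "dual C = \<lparr>points = lines C, lines = points C, inc = (inc C)\<inverse>,
             col = (\<lambda>e. col C (case_sum Inr Inl ` e))\<rparr>"

definition projective_plane :: "('p, 'l) config \<Rightarrow> bool" where
  "projective_plane C \<longleftrightarrow>
     (\<forall>p\<in>points C. \<forall>q\<in>points C. p \<noteq> q \<longrightarrow>
        (\<exists>!l. l \<in> lines C \<and> (p, l) \<in> inc C \<and> (q, l) \<in> inc C)) \<and>
     (\<forall>l\<in>lines C. \<forall>m\<in>lines C. l \<noteq> m \<longrightarrow>
        (\<exists>!p. p \<in> points C \<and> (p, l) \<in> inc C \<and> (p, m) \<in> inc C)) \<and>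
     (\<exists>S \<subseteq> points C. card S = 4 \<and>
        (\<forall>T \<subseteq> S. card T = 3 \<longrightarrow> \<not> (\<exists>l\<in>lines C. \<forall>p\<in>T. (p, l) \<in> inc C)))"


subsection \<open>Homomorphisms, automorphisms and actions\<close>

text \<open>A homomorphism is a triple of maps on points, lines and colors; the maps are extensional, so
  that equality of homomorphisms is equality in HOL.\<close>

type_synonym ('p, 'l, 'q, 'm) config_map = "('p \<Rightarrow> 'q) \<times> ('l \<Rightarrow> 'm) \<times> (nat \<Rightarrow> nat)"

definition config_homs ::
  "nat \<Rightarrow> ('p, 'l) config \<Rightarrow> ('q, 'm) config \<Rightarrow> ('p, 'l, 'q, 'm) config_map set" where
  "config_homs k C D =
     {(f, g, h). f \<in> points C \<rightarrow>\<^sub>E points D \<and> g \<in> lines C \<rightarrow>\<^sub>E lines D \<and> h \<in> {1..k} \<rightarrow>\<^sub>E {1..k} \<and>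
        (\<forall>(p, l) \<in> inc C. (f p, g l) \<in> inc D \<and>
           col D {Inl (f p), Inr (g l)} = h (col C {Inl p, Inr l}))}"

definition config_End :: "nat \<Rightarrow> ('p, 'l) config \<Rightarrow> ('p, 'l, 'p, 'l) config_map monoid" where
  "config_End k C =
     \<lparr>carrier = config_homs k C C,
      monoid.mult = (\<lambda>(f, g, h) (f', g', h').
        (compose (points C) f f', compose (lines C) g g', compose {1..k} h h')),
      one = (\<lambda>p\<in>points C. p, \<lambda>l\<in>lines C. l, \<lambda>c\<in>{1..k}. c)\<rparr>"

definition config_Aut :: "nat \<Rightarrow> ('p, 'l) config \<Rightarrow> ('p, 'l, 'p, 'l) config_map monoid" where
  "config_Aut k C = units_of (config_End k C)"

definition config_action ::
  "('g, 'b) monoid_scheme \<Rightarrow> nat \<Rightarrow> ('p, 'l) config \<Rightarrow> ('g \<Rightarrow> ('p, 'l, 'p, 'l) config_map) \<Rightarrow> bool" where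
  "config_action G k C \<rho> \<longleftrightarrow> group G \<and> \<rho> \<in> hom G (config_Aut k C)"


section \<open>Simplicial complexes\<close>

text \<open>Finite abstract simplicial complexes, represented by the set of their nonempty faces.\<close>

definition finite_complex :: "'v set set \<Rightarrow> bool" where
  "finite_complex X \<longleftrightarrow>
     finite X \<and> (\<forall>\<sigma>\<in>X. finite \<sigma> \<and> \<sigma> \<noteq> {}) \<and> (\<forall>\<sigma>\<in>X. \<forall>\<tau>. \<tau> \<subseteq> \<sigma> \<and> \<tau> \<noteq> {} \<longrightarrow> \<tau> \<in> X)"

definition verts :: "'v set set \<Rightarrow> 'v set" where
  "verts X = \<Union>X"

definition facets :: "'v set set \<Rightarrow> 'v set set" where
  "facets X = {\<sigma>\<in>X. \<forall>\<tau>\<in>X. \<sigma> \<subseteq> \<tau> \<longrightarrow> \<sigma> = \<tau>}"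

definition has_dimension :: "'v set set \<Rightarrow> nat \<Rightarrow> bool" where
  "has_dimension X k \<longleftrightarrow> (\<forall>\<sigma>\<in>X. card \<sigma> \<le> k + 1) \<and> (\<exists>\<sigma>\<in>X. card \<sigma> = k + 1)"

definition two_neighborly :: "'v set set \<Rightarrow> bool" where
  "two_neighborly X \<longleftrightarrow> (\<forall>u\<in>verts X. \<forall>v\<in>verts X. u \<noteq> v \<longrightarrow> {u, v} \<in> X)"

text \<open>Barycentric coordinates. For a finite complex the topology induced by the product topology on
  \<open>'v \<Rightarrow> real\<close> is the usual topology of the geometric realization.\<close>

definition realization :: "'v set set \<Rightarrow> ('v \<Rightarrow> real) set" where
  "realization X =
     {x. (\<forall>v. 0 \<le> x v) \<and> {v. x v \<noteq> 0} \<in> X \<and> (\<Sum>v | x v \<noteq> 0. x v) = 1}"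

definition complex_End :: "'v set set \<Rightarrow> ('v \<Rightarrow> 'v) monoid" where
  "complex_End X =
     \<lparr>carrier = {f \<in> verts X \<rightarrow>\<^sub>E verts X. \<forall>\<sigma>\<in>X. f ` \<sigma> \<in> X},
      monoid.mult = compose (verts X),
      one = (\<lambda>v\<in>verts X. v)\<rparr>"

definition complex_Aut :: "'v set set \<Rightarrow> ('v \<Rightarrow> 'v) monoid" where
  "complex_Aut X = units_of (complex_End X)"

definition complex_action ::
  "('g, 'b) monoid_scheme \<Rightarrow> 'v set set \<Rightarrow> ('g \<Rightarrow> 'v \<Rightarrow> 'v) \<Rightarrow> bool" where
  "complex_action G X \<theta> \<longleftrightarrow> group G \<and> \<theta> \<in> hom G (complex_Aut X)"


section \<open>The fundamental group\<close>

definition path_class :: "'a::topological_space set \<Rightarrow> (real \<Rightarrow> 'a) \<Rightarrow> (real \<Rightarrow> 'a) set" where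
  "path_class S p = {q. homotopic_paths S p q}"

definition fundamental_group :: "'a::topological_space set \<Rightarrow> 'a \<Rightarrow> (real \<Rightarrow> 'a) set monoid" where
  "fundamental_group S x =
     \<lparr>carrier = {path_class S p | p.
        path p \<and> path_image p \<subseteq> S \<and> pathstart p = x \<and> pathfinish p = x},
      monoid.mult = (\<lambda>A B. \<Union>p\<in>A. \<Union>q\<in>B. path_class S (p +++ q)),
      one = path_class S (\<lambda>_. x)\<rparr>"

definition int_power_group :: "nat \<Rightarrow> (nat \<Rightarrow> int) monoid" where
  "int_power_group k = product_group {..<k} (\<lambda>_. integer_group)"


section \<open>Configurations in simplicial complexes\<close>

text \<open>The points of \<open>C\<close> correspond via \<open>\<alpha>\<close> to all vertices of \<open>X\<close>, and the lines of \<open>C\<close> correspond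
  via \<open>\<Lambda>\<close> to the facets in \<open>F\<close>.\<close>

definition config_copy ::
  "('p, 'l) config \<Rightarrow> 'v set set \<Rightarrow> ('p \<Rightarrow> 'v) \<Rightarrow> ('l \<Rightarrow> 'v set) \<Rightarrow> 'v set set \<Rightarrow> bool" where
  "config_copy C X \<alpha> \<Lambda> F \<longleftrightarrow>
     F \<subseteq> facets X \<and> bij_betw \<alpha> (points C) (verts X) \<and> bij_betw \<Lambda> (lines C) F \<and>
     (\<forall>p\<in>points C. \<forall>l\<in>lines C. (p, l) \<in> inc C \<longleftrightarrow> \<alpha> p \<in> \<Lambda> l)"

text \<open>The action on points of an action \<open>\<rho>\<close> on \<open>C\<close>, transported to the vertices of \<open>X\<close> by \<open>\<alpha>\<close>.\<close>

definition transported_action ::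
  "('p, 'l) config \<Rightarrow> 'v set set \<Rightarrow> ('p \<Rightarrow> 'v) \<Rightarrow> ('g \<Rightarrow> ('p, 'l, 'p, 'l) config_map) \<Rightarrow> 'g \<Rightarrow> 'v \<Rightarrow> 'v" where
  "transported_action C X \<alpha> \<rho> g = (\<lambda>v\<in>verts X. \<alpha> (fst (\<rho> g) (inv_into (points C) \<alpha> v)))"

end

theory Submission
  imports Defs "HOL-Complex_Analysis.Complex_Analysis"
begin

text \<open>
  In a configuration with the 6-cycle property, let \<open>s a b\<close> be the permutation of the points that first
  follows color \<open>a\<close> to a line and then color \<open>b\<close> back to a point. The 6-cycle property says exactly that
  these permutations behave like the translations by \<open>e\<^sub>a - e\<^sub>b\<close> of the root lattice \<open>A\<^sub>k\<close>, so that the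
  points form a quotient of \<open>A\<^sub>k\<close> by a sublattice \<open>\<Gamma>\<close> of finite index. The facets of \<open>X\<close> are the images of
  the simplices \<open>{p + e\<^sub>a - e\<^sub>c | c}\<close> (the lines) and \<open>{p + e\<^sub>c - e\<^sub>a | c}\<close>.

  Every path in the realization is homotopic to an edge path, that is, a word in the letters \<open>e\<^sub>a - e\<^sub>b\<close>.
  The triangles of \<open>X\<close> make letters commute and add up, hence words with the same sum are homotopic.
  Conversely, the coordinates of the lattice define maps from \<open>X\<close> to the circle, and winding numbers recover
  the sum of a closed word. So the fundamental group is the group \<open>\<Gamma>\<close> of sums of closed words, a subgroup
  of \<open>\<int>\<^sup>k\<close> that contains a multiple of every unit vector, and therefore isomorphic to \<open>\<int>\<^sup>k\<close>.
\<close>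

text \<open>The two orders of composing translations behave differently. Moving by
  \<open>e_a - e_b\<close> and then by \<open>e_b - e_c\<close> stays on one line, so it amounts to
  \<open>e_a - e_c\<close> for purely formal reasons. The opposite order changes the line, and its
  agreement with \<open>e_a - e_c\<close> is the content of the 6-cycle property. The triangles for
  the first order lie in the facets of lines, those for the second in the facets of dual lines.
  Splitting a letter in one order and fusing in the other is what makes letters commute. The axiom
  that two points share at most one line makes the vector between adjacent vertices well defined,
  and this lets coordinates descend to circle maps. The circle maps take the place of a universal
  cover: neither the lattice nor its quotient is built. The \<open>k + 1\<close> coordinates of a
  word add up to 0, so \<open>k\<close> of them determine it. Finiteness of the point set makes each
  repeated letter return to its start, whence full rank \<open>k\<close>.\<close>

section \<open>Path homotopies in topological spaces\<close>

text \<open>The library states the groupoid laws only in normed spaces. Here they follow from the fact that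
  two paths in the unit interval with the same endpoints are homotopic.\<close>

lemma homotopic_paths_comp_unit_interval:
  fixes g :: "real \<Rightarrow> 'a::topological_space" and f f' :: "real \<Rightarrow> real"
  assumes "path g" "path_image g \<subseteq> S"
    and "path f" "path_image f \<subseteq> {0..1}" "path f'" "path_image f' \<subseteq> {0..1}"
    and "pathstart f = pathstart f'" "pathfinish f = pathfinish f'"
  shows "homotopic_paths S (g \<circ> f) (g \<circ> f')"
proof (rule homotopic_paths_continuous_image)
  have "closed_segment (f t) (f' t) \<subseteq> {0..1}" if "t \<in> {0..1}" for t
    using assms that unfolding path_image_def
    by (intro closed_segment_subset) (auto simp: image_subset_iff)
  then show "homotopic_paths {0..1} f f'"
    using assms by (intro homotopic_paths_linear) auto
  show "continuous_on {0..1} g" "g \<in> {0..1} \<rightarrow> S"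
    using assms by (auto simp: path_def path_image_def)
qed

lemma path_comp_linepath:
  assumes "path g" "u \<in> {0..1}" "v \<in> {0..1}"
  shows "path (g \<circ> linepath u v)"
proof -
  have "linepath u v ` {0..1} \<subseteq> {0..1}"
    using assms linepath_image_01[of u v] closed_segment_subset[of u "{0..1}" v] by auto
  then show ?thesis
    using assms by (intro path_continuous_image) (auto simp: path_def path_image_def intro: continuous_on_subset)
qed

text \<open>Both sides are \<open>g\<close> after a path in the unit interval from \<open>u\<close>
  to \<open>w\<close>. The unit and inverse laws below are the instances with \<open>u\<close>,
  \<open>v\<close>, \<open>w\<close> among 0 and 1.\<close>

lemma homotopic_paths_join_linepath:
  fixes g :: "real \<Rightarrow> 'a::topological_space"
  assumes "path g" "path_image g \<subseteq> S" "u \<in> {0..1}" "v \<in> {0..1}" "w \<in> {0..1}"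
  shows "homotopic_paths S ((g \<circ> linepath u v) +++ (g \<circ> linepath v w)) (g \<circ> linepath u w)"
proof -
  have s: "path_image (linepath a b) \<subseteq> {0..1}" if "a \<in> {0..1}" "b \<in> {0..1}" for a b :: real
    using that closed_segment_subset[of a "{0..1}" b] by auto
  show ?thesis
    unfolding path_compose_join[symmetric]
    using assms s by (intro homotopic_paths_comp_unit_interval path_join_imp subset_path_image_join) auto
qed

lemma comp_linepath_same: "g \<circ> linepath u u = (\<lambda>_. g u)"
  by (auto simp: linepath_def algebra_simps)

lemma comp_linepath_01: "g \<circ> linepath 0 1 = g"
  by (auto simp: linepath_def)

lemma comp_linepath_10: "g \<circ> linepath 1 0 = reversepath g"
  by (auto simp: linepath_def reversepath_def)

lemmas comp_linepath = comp_linepath_same comp_linepath_01 comp_linepath_10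

lemma homotopic_paths_rid_const:
  fixes g :: "real \<Rightarrow> 'a::topological_space"
  assumes "path g" "path_image g \<subseteq> S" "x = pathfinish g"
  shows "homotopic_paths S (g +++ (\<lambda>_. x)) g"
  using homotopic_paths_join_linepath[OF assms(1,2), of 0 1 1] assms(3)
  by (simp add: comp_linepath pathfinish_def)

lemma homotopic_paths_lid_const:
  fixes g :: "real \<Rightarrow> 'a::topological_space"
  assumes "path g" "path_image g \<subseteq> S" "x = pathstart g"
  shows "homotopic_paths S ((\<lambda>_. x) +++ g) g"
  using homotopic_paths_join_linepath[OF assms(1,2), of 0 0 1] assms(3)
  by (simp add: comp_linepath pathstart_def)

lemma homotopic_paths_rinv_const:
  fixes g :: "real \<Rightarrow> 'a::topological_space"
  assumes "path g" "path_image g \<subseteq> S" "x = pathstart g"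
  shows "homotopic_paths S (g +++ reversepath g) (\<lambda>_. x)"
  using homotopic_paths_join_linepath[OF assms(1,2), of 0 1 0] assms(3)
  by (simp add: comp_linepath pathstart_def)

section \<open>Polygonal paths in the realization of a complex\<close>

definition supp :: "('v \<Rightarrow> real) \<Rightarrow> 'v set" where
  "supp x = {v. x v \<noteq> 0}"

definition vertex :: "'v \<Rightarrow> 'v \<Rightarrow> real" where
  "vertex v = (\<lambda>w. if w = v then 1 else 0)"

definition seg :: "('v \<Rightarrow> real) \<Rightarrow> ('v \<Rightarrow> real) \<Rightarrow> real \<Rightarrow> 'v \<Rightarrow> real" where
  "seg x y t = (\<lambda>v. (1 - t) * x v + t * y v)"

fun polygonal :: "('v \<Rightarrow> real) list \<Rightarrow> real \<Rightarrow> 'v \<Rightarrow> real" where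
  "polygonal [] = (\<lambda>_ _. 0)"
| "polygonal [x] = (\<lambda>_. x)"
| "polygonal (x # y # zs) = seg x y +++ polygonal (y # zs)"

lemma supp_vertex [simp]: "supp (vertex v) = {v}"
  by (auto simp: supp_def vertex_def)

lemma pathstart_seg [simp]: "pathstart (seg x y) = x"
  and pathfinish_seg [simp]: "pathfinish (seg x y) = y"
  by (auto simp: pathstart_def pathfinish_def seg_def)

lemma seg_same: "seg x x = (\<lambda>_. x)"
  by (auto simp: seg_def algebra_simps fun_eq_iff)

lemma path_seg: "path (seg x y)"
  unfolding path_def seg_def
  by (intro continuous_on_coordinatewise_then_product continuous_intros)

lemma pathstart_polygonal [simp]: "pathstart (polygonal (x # xs)) = x"
  by (cases xs) (auto simp: pathstart_def[of "\<lambda>_. x"])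

lemma pathfinish_polygonal: "xs \<noteq> [] \<Longrightarrow> pathfinish (polygonal xs) = last xs"
  by (induction xs rule: polygonal.induct) (auto simp: pathfinish_def[of "\<lambda>_. _"])

locale simplicial_complex =
  fixes X :: "'v set set"
  assumes finite_complex: "finite_complex X"
begin

text \<open>Such points lie in a common closed simplex, so the segment between them stays in the
  realization. This replaces adjacency of vertices, since base points and points of a path need not
  be vertices.\<close>

definition compatible :: "('v \<Rightarrow> real) \<Rightarrow> ('v \<Rightarrow> real) \<Rightarrow> bool" where
  "compatible x y \<longleftrightarrow> supp x \<union> supp y \<in> X"

abbreviation R where "R \<equiv> realization X"

definition polygon :: "('v \<Rightarrow> real) list \<Rightarrow> bool" where
  "polygon xs \<longleftrightarrow> xs \<noteq> [] \<and> set xs \<subseteq> R \<and> successively compatible xs"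

lemma face_subset: "\<sigma> \<in> X \<Longrightarrow> \<tau> \<subseteq> \<sigma> \<Longrightarrow> \<tau> \<noteq> {} \<Longrightarrow> \<tau> \<in> X"
  and face_finite: "\<sigma> \<in> X \<Longrightarrow> finite \<sigma>"
  and face_nonempty: "\<sigma> \<in> X \<Longrightarrow> \<sigma> \<noteq> {}"
  using finite_complex unfolding finite_complex_def by blast+

lemma realization_iff:
  "x \<in> R \<longleftrightarrow> (\<forall>v. 0 \<le> x v) \<and> supp x \<in> X \<and> (\<Sum>v\<in>supp x. x v) = 1"
  by (simp add: realization_def supp_def)

lemma sum_realization:
  assumes "x \<in> R" "supp x \<subseteq> T" "finite T"
  shows "(\<Sum>v\<in>T. x v) = 1"
proof -
  have "(\<Sum>v\<in>T. x v) = (\<Sum>v\<in>supp x. x v)"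
    using assms by (intro sum.mono_neutral_right) (auto simp: supp_def)
  then show ?thesis
    using assms(1) by (simp add: realization_iff)
qed

lemma supp_nonempty: "x \<in> R \<Longrightarrow> supp x \<noteq> {}"
  using face_nonempty by (auto simp: realization_iff)

lemma vertex_in_realization [intro]: "{v} \<in> X \<Longrightarrow> vertex v \<in> R"
  using supp_vertex[of v] unfolding realization_iff by (simp add: vertex_def)

lemma supp_seg_subset: "supp (seg x y t) \<subseteq> supp x \<union> supp y"
  by (auto simp: supp_def seg_def)

lemma seg_in_realization:
  assumes "x \<in> R" "y \<in> R" "compatible x y" "0 \<le> t" "t \<le> 1"
  shows "seg x y t \<in> R"
proof -
  have fin: "finite (supp x \<union> supp y)"
    using assms face_finite unfolding compatible_def by blast
  have nonneg: "0 \<le> seg x y t v" for v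
    using assms by (auto simp: seg_def realization_iff)
  have "(\<Sum>v\<in>supp x \<union> supp y. seg x y t v) = (1 - t) * (\<Sum>v\<in>supp x \<union> supp y. x v) + t * (\<Sum>v\<in>supp x \<union> supp y. y v)"
    by (simp add: seg_def sum.distrib sum_distrib_left)
  also have "\<dots> = 1"
    using assms fin by (simp add: sum_realization)
  finally have sum1: "(\<Sum>v\<in>supp x \<union> supp y. seg x y t v) = 1" .
  have eq: "(\<Sum>v\<in>supp (seg x y t). seg x y t v) = (\<Sum>v\<in>supp x \<union> supp y. seg x y t v)"
    using fin supp_seg_subset[of x y t] by (intro sum.mono_neutral_left) (auto simp: supp_def)
  have "supp (seg x y t) \<noteq> {}"
    using eq sum1 by auto
  then have "supp (seg x y t) \<in> X"
    using face_subset[OF _ supp_seg_subset] assms(3) unfolding compatible_def by blast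
  then show ?thesis
    using nonneg eq sum1 by (simp add: realization_iff)
qed

lemma compatible_refl: "x \<in> R \<Longrightarrow> compatible x x"
  by (simp add: compatible_def realization_iff)

lemma path_image_seg: "x \<in> R \<Longrightarrow> y \<in> R \<Longrightarrow> compatible x y \<Longrightarrow> path_image (seg x y) \<subseteq> R"
  by (auto simp: path_image_def intro: seg_in_realization)

text \<open>At each time the two points share a simplex, so the straight-line homotopy never leaves
  the realization.\<close>

lemma homotopic_paths_straight:
  assumes "path p" "path q" "path_image p \<subseteq> R" "path_image q \<subseteq> R"
    and "pathstart p = pathstart q" "pathfinish p = pathfinish q"
    and "\<And>t. t \<in> {0..1} \<Longrightarrow> compatible (p t) (q t)"
  shows "homotopic_paths R p q"
  unfolding homotopic_paths
proof (intro exI conjI ballI)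
  let ?h = "\<lambda>(s, t). seg (p t) (q t) s"
  have c: "continuous_on ({0..1} \<times> {0..1}) (\<lambda>z. r (snd z) v)" if "path r" for r :: "real \<Rightarrow> 'v \<Rightarrow> real" and v
  proof -
    have "continuous_on ({0..1} \<times> {0..1}) (\<lambda>z. r (snd z))"
      using that unfolding path_def by (rule continuous_on_compose2) (auto intro: continuous_intros)
    then show ?thesis
      by (rule continuous_on_product_then_coordinatewise)
  qed
  show "continuous_on ({0..1} \<times> {0..1}) ?h"
    unfolding seg_def case_prod_unfold
    by (intro continuous_on_coordinatewise_then_product continuous_intros c assms)
  show "?h \<in> {0..1} \<times> {0..1} \<rightarrow> R"
    using assms(3,4,7) by (auto simp: path_image_def intro!: seg_in_realization)
qed (use assms(5,6) in \<open>auto simp: seg_def pathstart_def pathfinish_def algebra_simps\<close>)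

lemma homotopic_paths_in_simplex:
  assumes "path p" "path q" "path_image p \<subseteq> R" "path_image q \<subseteq> R"
    and "pathstart p = pathstart q" "pathfinish p = pathfinish q"
    and "\<sigma> \<in> X" "\<And>t. t \<in> {0..1} \<Longrightarrow> supp (p t) \<subseteq> \<sigma>" "\<And>t. t \<in> {0..1} \<Longrightarrow> supp (q t) \<subseteq> \<sigma>"
  shows "homotopic_paths R p q"
proof (rule homotopic_paths_straight[OF assms(1-6)])
  fix t :: real assume t: "t \<in> {0..1}"
  have "p t \<in> R"
    using assms(3) t by (auto simp: path_image_def)
  then have "supp (p t) \<noteq> {}"
    by (rule supp_nonempty)
  then show "compatible (p t) (q t)"
    unfolding compatible_def using assms(7-9) t by (intro face_subset[OF assms(7)]) auto
qed

section \<open>Polygons and their elementary moves\<close>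

lemma polygon_Cons [simp]: "polygon (x # y # zs) \<longleftrightarrow> x \<in> R \<and> compatible x y \<and> polygon (y # zs)"
  by (auto simp: polygon_def)

lemma polygon_singleton [simp]: "polygon [x] \<longleftrightarrow> x \<in> R"
  by (auto simp: polygon_def)

lemma polygon_nonempty [simp]: "\<not> polygon []"
  by (auto simp: polygon_def)

lemma polygon_append:
  "polygon (xs @ [x] @ ys) \<longleftrightarrow> polygon (xs @ [x]) \<and> polygon (x # ys)"
  by (auto simp: polygon_def successively_append_iff)

lemma polygonal_path:
  "polygon xs \<Longrightarrow> path (polygonal xs) \<and> path_image (polygonal xs) \<subseteq> R"
proof (induction xs rule: polygonal.induct)
  case (2 x)
  then show ?case by (simp add: path_def path_image_def image_subset_iff)
next
  case (3 x y zs)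
  moreover have "y \<in> R"
    using 3 by (auto simp: polygon_def)
  ultimately show ?case
    using path_image_seg[of x y] by (auto simp: path_seg path_image_join)
qed simp

text \<open>The left side is bracketed at the split, whereas \<open>polygonal\<close> brackets to
  the right; reassociation moves the segments of the first list across one at a time.\<close>

lemma polygonal_join:
  assumes "polygon (xs @ [x])" "polygon (x # ys)"
  shows "homotopic_paths R (polygonal (xs @ [x]) +++ polygonal (x # ys)) (polygonal (xs @ [x] @ ys))"
  using assms(1)
proof (induction xs)
  case Nil
  then show ?case
    using polygonal_path[OF assms(2)] by (auto intro: homotopic_paths_lid_const)
next
  case (Cons a xs)
  obtain b bs where b: "xs @ [x] = b # bs"
    by (cases "xs @ [x]") auto
  have p: "polygon (b # bs)" "a \<in> R" "compatible a b"
    using Cons.prems b by auto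
  have bR: "b \<in> R"
    using p(1) by (auto simp: polygon_def)
  have fin: "pathfinish (polygonal (b # bs)) = x"
    using pathfinish_polygonal[of "b # bs"] b by (metis last_snoc list.distinct(1))
  have b': "xs @ x # ys = b # bs @ ys"
    using b by (metis append_Cons append_Nil append_assoc)
  note pth = polygonal_path[OF p(1)] polygonal_path[OF assms(2)] path_seg[of a b] path_image_seg[OF p(2) bR p(3)]
  have "homotopic_paths R (polygonal (a # xs @ [x]) +++ polygonal (x # ys))
      (seg a b +++ (polygonal (xs @ [x]) +++ polygonal (x # ys)))"
    unfolding b polygonal.simps using pth fin
    by (intro homotopic_paths_sym[OF homotopic_paths_assoc]) auto
  also have "homotopic_paths R \<dots> (seg a b +++ polygonal (xs @ [x] @ ys))"
    using Cons.IH p(1) pth unfolding b by (intro homotopic_paths_join) auto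
  finally show ?case
    by (simp add: b')
qed

text \<open>The elementary move behind all later homotopies of polygons: inside a simplex containing
  \<open>x\<close>, \<open>y\<close>, \<open>z\<close> the detour via \<open>y\<close> contracts to
  the direct segment.\<close>

lemma polygonal_remove_middle:
  assumes "polygon (xs @ [x, y, z] @ zs)" "supp x \<union> supp y \<union> supp z \<in> X"
  shows "polygon (xs @ [x, z] @ zs)"
    and "homotopic_paths R (polygonal (xs @ [x, y, z] @ zs)) (polygonal (xs @ [x, z] @ zs))"
proof -
  have p: "polygon (xs @ [x])" "x \<in> R" "y \<in> R" "z \<in> R" "compatible x y" "compatible y z" "polygon (z # zs)"
    using assms(1) polygon_append[of xs x "y # z # zs"] by (auto simp: polygon_def)
  have xz: "compatible x z"
    unfolding compatible_def using supp_nonempty[OF p(2)] by (intro face_subset[OF assms(2)]) auto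
  have q: "polygon (x # z # zs)"
    using p xz by auto
  show "polygon (xs @ [x, z] @ zs)"
    using p q polygon_append[of xs x "z # zs"] by auto
  have r: "polygon (x # y # z # zs)"
    using p by auto
  have triangle: "homotopic_paths R (seg x y +++ seg y z) (seg x z)"
  proof (rule homotopic_paths_in_simplex[OF _ _ _ _ _ _ assms(2)])
    show "path_image (seg x y +++ seg y z) \<subseteq> R" "path_image (seg x z) \<subseteq> R"
      using path_image_seg p xz by (auto simp: path_image_join)
    show "supp ((seg x y +++ seg y z) t) \<subseteq> supp x \<union> supp y \<union> supp z" for t
      using supp_seg_subset[of x y "2 * t"] supp_seg_subset[of y z "2 * t - 1"] by (auto simp: joinpaths_def)
    show "supp (seg x z t) \<subseteq> supp x \<union> supp y \<union> supp z" for t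
      using supp_seg_subset[of x z t] by auto
  qed (auto simp: path_seg)
  have "homotopic_paths R (polygonal (x # y # z # zs)) ((seg x y +++ seg y z) +++ polygonal (z # zs))"
    unfolding polygonal.simps using p path_image_seg polygonal_path[OF p(7)]
    by (intro homotopic_paths_assoc) (auto simp: path_seg)
  also have "homotopic_paths R \<dots> (seg x z +++ polygonal (z # zs))"
    using triangle polygonal_path[OF p(7)] by (intro homotopic_paths_join) auto
  finally have tail: "homotopic_paths R (polygonal (x # y # z # zs)) (polygonal (x # z # zs))"
    by simp
  have "homotopic_paths R (polygonal (xs @ [x, y, z] @ zs)) (polygonal (xs @ [x]) +++ polygonal (x # y # z # zs))"
    using polygonal_join[OF p(1) r] by (simp add: homotopic_paths_sym_eq)
  also have "homotopic_paths R \<dots> (polygonal (xs @ [x]) +++ polygonal (x # z # zs))"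
    using tail polygonal_path[OF p(1)] by (intro homotopic_paths_join) (auto simp: pathfinish_polygonal)
  also have "homotopic_paths R \<dots> (polygonal (xs @ [x, z] @ zs))"
    using polygonal_join[OF p(1) q] by simp
  finally show "homotopic_paths R (polygonal (xs @ [x, y, z] @ zs)) (polygonal (xs @ [x, z] @ zs))" .
qed

text \<open>Bisection reduces the claim to short intervals. A positive barycentric coordinate stays
  positive nearby, so a short piece of the path runs in the open star of one vertex \<open>v\<close>
  and can be pushed straight to a detour through \<open>v\<close>.\<close>

lemma path_homotopic_polygonal:
  assumes "path g" "path_image g \<subseteq> R"
  obtains xs where "polygon xs" "hd xs = pathstart g" "last xs = pathfinish g" "homotopic_paths R g (polygonal xs)"
proof -
  \<comment> \<open>Bisection quantifies over all real intervals, hence the containment in the unit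
    interval is a premise inside \<open>Q\<close>.\<close>
  define Q where "Q a b \<longleftrightarrow> ({a, b} \<subseteq> {0..1} \<longrightarrow> (\<exists>xs. polygon xs \<and> hd xs = g a \<and> last xs = g b \<and>
    homotopic_paths R (g \<circ> linepath a b) (polygonal xs)))" for a b
  have "(0::real) \<le> 1"
    by simp
  then have "Q 0 1"
  proof (induct rule: Bolzano)
    case (trans a b c)
    show ?case
      unfolding Q_def
    proof
      assume ac: "{a, c} \<subseteq> {0..1}"
      obtain xs ys where xs: "polygon xs" "hd xs = g a" "last xs = g b" "homotopic_paths R (g \<circ> linepath a b) (polygonal xs)"
        and ys: "polygon ys" "hd ys = g b" "last ys = g c" "homotopic_paths R (g \<circ> linepath b c) (polygonal ys)"
        using trans ac unfolding Q_def by force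
      obtain xs' ys' where e: "xs = xs' @ [g b]" "ys = g b # ys'"
        using xs(1,3) ys(1,2) by (metis append_butlast_last_id list.collapse polygon_nonempty)
      have "homotopic_paths R (g \<circ> linepath a c) ((g \<circ> linepath a b) +++ (g \<circ> linepath b c))"
        using ac trans assms by (intro homotopic_paths_sym[OF homotopic_paths_join_linepath]) auto
      also have "homotopic_paths R \<dots> (polygonal xs +++ polygonal ys)"
        using xs ys by (intro homotopic_paths_join) (auto simp: pathfinish_compose pathstart_compose)
      also have "homotopic_paths R \<dots> (polygonal (xs' @ [g b] @ ys'))"
        using polygonal_join xs(1) ys(1) unfolding e by blast
      finally show "\<exists>xs. polygon xs \<and> hd xs = g a \<and> last xs = g c \<and> homotopic_paths R (g \<circ> linepath a c) (polygonal xs)"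
        using xs ys polygon_append[of xs' "g b" ys'] unfolding e
        by (intro exI[of _ "xs' @ [g b] @ ys'"]) (auto simp: hd_append split: if_splits)
    qed
  next
    case (local t)
    then have gt: "g t \<in> R"
      using assms by (auto simp: path_image_def)
    then obtain v where v: "v \<in> supp (g t)"
      using supp_nonempty by blast
    have "continuous_on {0..1} (\<lambda>s. g s v)"
      using assms(1) unfolding path_def by (rule continuous_on_product_then_coordinatewise)
    moreover have "g t v > 0"
      using v gt unfolding supp_def realization_iff by (simp add: less_le)
    ultimately obtain d where d: "d > 0" "\<And>s. s \<in> {0..1} \<Longrightarrow> dist s t < d \<Longrightarrow> dist (g s v) (g t v) < g t v"
      using local unfolding continuous_on_iff by (metis atLeastAtMost_iff)
    have pos: "v \<in> supp (g s)" if "s \<in> {0..1}" "dist s t < d" for s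
      using d(2)[OF that] by (auto simp: supp_def dist_real_def)
    have "Q a b" if "a \<le> t" "t \<le> b" "b - a < d" for a b
      unfolding Q_def
    proof
      assume ab: "{a, b} \<subseteq> {0..1}"
      have near: "g s \<in> R" "v \<in> supp (g s)" if "s \<in> {a..b}" for s
        using that ab \<open>b - a < d\<close> \<open>a \<le> t\<close> \<open>t \<le> b\<close> assms(2) by (auto intro!: pos simp: dist_real_def path_image_def)
      have compat: "compatible (g s) (vertex v)" "compatible (vertex v) (g s)" if "s \<in> {a..b}" for s
        using near[OF that] by (auto simp: compatible_def realization_iff insert_absorb)
      have vR: "vertex v \<in> R"
        using near[of a] that by (intro vertex_in_realization face_subset[of "supp (g a)" "{v}"]) (auto simp: realization_iff)
      have ends: "a \<in> {a..b}" "b \<in> {a..b}"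
        using that by auto
      have poly: "polygon [g a, vertex v, vertex v, g b]"
        using near compat vR ends compatible_refl by auto
      have r: "linepath a b s \<in> {a..b}" if "s \<in> {0..1}" for s
        using that ends linepath_image_01[of a b] closed_segment_eq_real_ivl[of a b] by (auto split: if_splits)
      have im: "path_image (g \<circ> linepath a b) \<subseteq> R"
        using r near by (force simp: path_image_def)
      have gp: "path (g \<circ> linepath a b)"
        using assms(1) ab by (intro path_comp_linepath) auto
      have ga: "path (\<lambda>_. g c)" "path_image (\<lambda>_. g c) \<subseteq> R" "pathstart (\<lambda>_. g c) = g c" "pathfinish (\<lambda>_. g c) = g c"
        if "c \<in> {a..b}" for c
        using near[OF that] by (auto simp: path_def path_image_def pathstart_def pathfinish_def)
      \<comment> \<open>The constant pieces make the four pieces of \<open>?g\<close> run in step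
        with those of the polygon. The doubled \<open>vertex v\<close> gives a stationary piece
        opposite the moving one, so that the two points are compatible at every time.\<close>
      let ?g = "(\<lambda>_. g a) +++ (g \<circ> linepath a b) +++ (\<lambda>_. g b) +++ (\<lambda>_. g b)"
      have bb: "homotopic_paths R ((\<lambda>_. g b) +++ (\<lambda>_. g b)) (\<lambda>_. g b)"
        using ga[OF ends(2)] by (intro homotopic_paths_rid_const) auto
      have "homotopic_paths R ((g \<circ> linepath a b) +++ (\<lambda>_. g b) +++ (\<lambda>_. g b)) ((g \<circ> linepath a b) +++ (\<lambda>_. g b))"
        using bb im gp ga ends by (intro homotopic_paths_join) (auto simp: pathfinish_compose)
      also have "homotopic_paths R \<dots> (g \<circ> linepath a b)"
        using im gp by (intro homotopic_paths_rid_const) (auto simp: pathfinish_compose)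
      finally have 1: "homotopic_paths R ((g \<circ> linepath a b) +++ (\<lambda>_. g b) +++ (\<lambda>_. g b)) (g \<circ> linepath a b)" .
      then have "homotopic_paths R ?g ((\<lambda>_. g a) +++ (g \<circ> linepath a b))"
        using ga ends by (intro homotopic_paths_join) (auto simp: pathstart_compose)
      also have "homotopic_paths R \<dots> (g \<circ> linepath a b)"
        using im gp by (intro homotopic_paths_lid_const) (auto simp: pathstart_compose)
      finally have 2: "homotopic_paths R ?g (g \<circ> linepath a b)" .
      have 3: "homotopic_paths R ?g (polygonal [g a, vertex v, vertex v, g b])"
      proof (rule homotopic_paths_straight)
        show "path ?g" "path_image ?g \<subseteq> R"
          using homotopic_paths_imp_path[OF 2] homotopic_paths_imp_subset[OF 2] by auto
        show "path (polygonal [g a, vertex v, vertex v, g b])" "path_image (polygonal [g a, vertex v, vertex v, g b]) \<subseteq> R"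
          using polygonal_path[OF poly] by auto
        show "pathstart ?g = pathstart (polygonal [g a, vertex v, vertex v, g b])"
          "pathfinish ?g = pathfinish (polygonal [g a, vertex v, vertex v, g b])"
          by (auto simp: pathstart_def pathfinish_def joinpaths_def seg_def)
        have star: "compatible (g s) (seg x y q)" if "s \<in> {a..b}" "supp x \<union> supp y \<subseteq> supp (g s)" for s x y q
        proof -
          have "supp (g s) \<union> supp (seg x y q) = supp (g s)"
            using supp_seg_subset[of x y q] that(2) by auto
          then show ?thesis
            using near[OF that(1)] by (simp add: compatible_def realization_iff)
        qed
        fix q :: real assume q: "q \<in> {0..1}"
        have "compatible (g a) (g a)" "compatible (g b) (g b)"
          using near ends compatible_refl by auto
        moreover have "linepath a b (2 * (2 * q - 1)) \<in> {a..b}" if "\<not> q * 2 \<le> 1" "2 * (q * 2 - 1) \<le> 1"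
          using that by (intro r) auto
        ultimately show "compatible (?g q) (polygonal [g a, vertex v, vertex v, g b] q)"
          using near ends unfolding polygonal.simps joinpaths_def
          by (auto intro!: star simp: mult.commute)
      qed
      have g: "homotopic_paths R (g \<circ> linepath a b) (polygonal [g a, vertex v, vertex v, g b])"
        using homotopic_paths_trans[OF homotopic_paths_sym[OF 2] 3] .
      then show "\<exists>xs. polygon xs \<and> hd xs = g a \<and> last xs = g b \<and> homotopic_paths R (g \<circ> linepath a b) (polygonal xs)"
        using poly g by (intro exI[of _ "[g a, vertex v, vertex v, g b]"]) auto
    qed
    then show ?case
      using d(1) by blast
  qed
  then show ?thesis
    unfolding Q_def using that by (auto simp: comp_linepath pathstart_def pathfinish_def)
qed

end

section \<open>Lattices in \<open>\<int>\<^sup>k\<close>\<close>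

text \<open>Division with remainder by the least positive element; closure under differences gives
  closure under multiples, and \<open>N\<close> guarantees that a positive element exists.\<close>

lemma int_subgroup_generator:
  fixes S :: "int set"
  assumes "N \<in> S" "N \<noteq> 0" and diff: "\<And>x y. x \<in> S \<Longrightarrow> y \<in> S \<Longrightarrow> x - y \<in> S"
  obtains d where "d \<in> S" "d \<noteq> 0" "\<And>x. x \<in> S \<Longrightarrow> d dvd x"
proof -
  have zero: "0 \<in> S"
    using diff[OF assms(1,1)] by simp
  have neg: "- x \<in> S" if "x \<in> S" for x
    using diff[OF zero that] by simp
  have add: "x + y \<in> S" if "x \<in> S" "y \<in> S" for x y
    using diff[OF that(1) neg[OF that(2)]] by simp
  have mult_nat: "int n * x \<in> S" if "x \<in> S" for n x
    by (induction n) (auto simp: zero add that distrib_right)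
  have mult: "m * x \<in> S" if "x \<in> S" for m x
    using mult_nat[OF that] neg[OF mult_nat[OF that]] by (cases m rule: int_cases2) auto
  have ex: "\<exists>n. n > 0 \<and> int n \<in> S"
    using assms(1,2) neg[OF assms(1)] by (cases N rule: int_cases2) auto
  define n where "n = (LEAST n. n > 0 \<and> int n \<in> S)"
  have n: "n > 0" "int n \<in> S"
    using LeastI_ex[OF ex] unfolding n_def by auto
  have "int n dvd x" if "x \<in> S" for x
  proof (rule ccontr)
    assume "\<not> int n dvd x"
    then have "x mod int n > 0"
      using n(1) by (metis dvd_eq_mod_eq_0 of_nat_0_less_iff order_le_less pos_mod_sign)
    moreover have "x mod int n \<in> S"
      using diff[OF that mult[OF n(2), of "x div int n"]] by (simp add: minus_div_mult_eq_mod)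
    ultimately have "n \<le> nat (x mod int n)"
      unfolding n_def by (intro Least_le) (auto simp: n_def)
    moreover have "0 \<le> x mod int n"
      using n(1) by simp
    moreover have "x mod int n < int n"
      using n(1) by simp
    ultimately show False
      by (simp add: le_nat_iff)
  qed
  then show thesis
    using that[of "int n"] n by auto
qed

text \<open>The coefficients are extensional, which makes them unique as functions and matches the
  carrier of the product group.\<close>

definition lattice_basis :: "nat \<Rightarrow> (nat \<Rightarrow> int) set \<Rightarrow> (nat \<Rightarrow> nat \<Rightarrow> int) \<Rightarrow> bool" where
  "lattice_basis k H b \<longleftrightarrow> (\<forall>c. (\<lambda>j. \<Sum>i<k. c i * b i j) \<in> H) \<and>
     (\<forall>f\<in>H. \<exists>!c. c \<in> {..<k} \<rightarrow>\<^sub>E UNIV \<and> f = (\<lambda>j. \<Sum>i<k. c i * b i j))"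

text \<open>Induction by projecting to the last coordinate: the image in the integers is generated
  by some \<open>d\<close>, and any \<open>h\<close> above \<open>d\<close> completes a basis of the
  kernel \<open>H'\<close>. The multiples of unit vectors keep \<open>d\<close> nonzero at each
  stage, so the basis has exactly \<open>k\<close> members.\<close>

lemma ex_lattice_basis:
  fixes H :: "(nat \<Rightarrow> int) set"
  assumes "\<And>f i. f \<in> H \<Longrightarrow> i \<ge> k \<Longrightarrow> f i = 0"
    and "\<And>f g. f \<in> H \<Longrightarrow> g \<in> H \<Longrightarrow> (\<lambda>i. f i - g i) \<in> H"
    and "\<And>i. i < k \<Longrightarrow> \<exists>N>0. (\<lambda>j. if j = i then N else 0) \<in> H"
    and "(\<lambda>_. 0) \<in> H"
  shows "\<exists>b. lattice_basis k H b"
  using assms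
proof (induction k arbitrary: H)
  case 0
  then have "H = {\<lambda>_. 0}"
    by (auto simp: fun_eq_iff)
  then show ?case
    by (auto simp: lattice_basis_def)
next
  case (Suc k)
  define H' where "H' = {f \<in> H. f k = 0}"
  have "\<exists>b. lattice_basis k H' b"
  proof (rule Suc.IH)
    show "f i = 0" if "f \<in> H'" "k \<le> i" for f i
      using that Suc.prems(1)[of f i] by (cases "i = k") (auto simp: H'_def)
    show "\<exists>N>0. (\<lambda>j. if j = i then N else 0) \<in> H'" if "i < k" for i
      using Suc.prems(3)[of i] that by (auto simp: H'_def)
  qed (use Suc.prems in \<open>auto simp: H'_def\<close>)
  then obtain b where basis: "lattice_basis k H' b"
    by blast
  have b: "(\<lambda>j. \<Sum>i<k. c i * b i j) \<in> H'" for c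
    using basis unfolding lattice_basis_def by blast
  have ex1: "\<exists>!c. c \<in> {..<k} \<rightarrow>\<^sub>E UNIV \<and> f = (\<lambda>j. \<Sum>i<k. c i * b i j)" if "f \<in> H'" for f
    using basis that unfolding lattice_basis_def by (elim conjE) (erule (1) bspec)
  obtain N where N: "N > 0" "(\<lambda>j. if j = k then N else 0) \<in> H"
    using Suc.prems(3)[of k] by auto
  obtain d where d: "d \<in> (\<lambda>f. f k) ` H" "d \<noteq> 0" "\<And>x. x \<in> (\<lambda>f. f k) ` H \<Longrightarrow> d dvd x"
  proof (rule int_subgroup_generator)
    show "N \<in> (\<lambda>f. f k) ` H"
      using imageI[OF N(2), of "\<lambda>f. f k"] by simp
    show "N \<noteq> 0"
      using N by simp
    show "x - y \<in> (\<lambda>f. f k) ` H" if "x \<in> (\<lambda>f. f k) ` H" "y \<in> (\<lambda>f. f k) ` H" for x y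
    proof -
      from that obtain f g where "f \<in> H" "x = f k" "g \<in> H" "y = g k"
        by blast
      then show ?thesis
        using imageI[OF Suc.prems(2)[of f g], of "\<lambda>f. f k"] by simp
    qed
  qed (rule that)
  obtain h where h: "h \<in> H" "h k = d"
    using d(1) by auto
  have neg: "(\<lambda>j. - f j) \<in> H" if "f \<in> H" for f
    using Suc.prems(2)[OF Suc.prems(4) that] by simp
  have add: "(\<lambda>j. f j + g j) \<in> H" if "f \<in> H" "g \<in> H" for f g
    using Suc.prems(2)[OF that(1) neg[OF that(2)]] by simp
  have mult_nat: "(\<lambda>j. int n * h j) \<in> H" for n
    by (induction n) (use h Suc.prems(4) in \<open>auto simp: distrib_right intro: add\<close>)
  have mult: "(\<lambda>j. m * h j) \<in> H" for m
    using mult_nat neg[OF mult_nat] by (cases m rule: int_cases2) auto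
  define b' where "b' = b(k := h)"
  have sum_b': "(\<Sum>i<Suc k. c i * b' i j) = (\<Sum>i<k. c i * b i j) + c k * h j" for c j
    by (simp add: b'_def)
  have zero: "(\<Sum>i<k. c i * b i k) = 0" for c
    using b[of c] by (simp add: H'_def)
  have "(\<lambda>j. \<Sum>i<Suc k. c i * b' i j) \<in> H" for c
    unfolding sum_b' using b[of c] mult by (intro add) (auto simp: H'_def)
  moreover have "\<exists>!c. c \<in> {..<Suc k} \<rightarrow>\<^sub>E UNIV \<and> f = (\<lambda>j. \<Sum>i<Suc k. c i * b' i j)" if f: "f \<in> H" for f
  proof -
    obtain m where m: "f k = d * m"
      using d(3) f by (metis dvdE image_eqI)
    have f': "(\<lambda>j. f j - m * h j) \<in> H'"
      using Suc.prems(2)[OF f mult[of m]] m h by (simp add: H'_def)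
    obtain c where c: "c \<in> {..<k} \<rightarrow>\<^sub>E UNIV \<and> (\<lambda>j. f j - m * h j) = (\<lambda>j. \<Sum>i<k. c i * b i j)"
      and uniq: "\<forall>c'. c' \<in> {..<k} \<rightarrow>\<^sub>E UNIV \<and> (\<lambda>j. f j - m * h j) = (\<lambda>j. \<Sum>i<k. c' i * b i j) \<longrightarrow> c' = c"
      using ex1[OF f'] by (rule ex1E)
    show ?thesis
    proof (intro ex1I conjI)
      show "c(k := m) \<in> {..<Suc k} \<rightarrow>\<^sub>E UNIV"
        using c by (auto simp: PiE_iff extensional_def)
      have "f j = (\<Sum>i<k. c i * b i j) + m * h j" for j
        using fun_cong[OF conjunct2[OF c], of j] by simp
      then show "f = (\<lambda>j. \<Sum>i<Suc k. (c(k := m)) i * b' i j)"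
        unfolding sum_b' by (intro ext) simp
    next
      fix c' assume "c' \<in> {..<Suc k} \<rightarrow>\<^sub>E UNIV \<and> f = (\<lambda>j. \<Sum>i<Suc k. c' i * b' i j)"
      then have c': "c' \<in> {..<Suc k} \<rightarrow>\<^sub>E UNIV" "\<And>j. f j = (\<Sum>i<k. c' i * b i j) + c' k * h j"
        unfolding sum_b' by (auto dest: fun_cong)
      have "c' k = m"
        using c'(2)[of k] zero m h d(2) by simp
      moreover have "restrict c' {..<k} = c"
        using c'(2) \<open>c' k = m\<close> by (intro uniq[rule_format] conjI) auto
      ultimately show "c' = c(k := m)"
        using c'(1) by (auto simp: fun_eq_iff PiE_iff extensional_def restrict_def split: if_splits)
    qed
  qed
  ultimately have "lattice_basis (Suc k) H b'"
    unfolding lattice_basis_def by (intro conjI allI ballI)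
  then show ?case
    by blast
qed

section \<open>Recognizing a free abelian fundamental group\<close>

definition loop_in :: "'a::topological_space set \<Rightarrow> 'a \<Rightarrow> (real \<Rightarrow> 'a) \<Rightarrow> bool" where
  "loop_in S x p \<longleftrightarrow> path p \<and> path_image p \<subseteq> S \<and> pathstart p = x \<and> pathfinish p = x"

lemma path_class_eq_iff:
  assumes "path p" "path_image p \<subseteq> S"
  shows "path_class S p = path_class S q \<longleftrightarrow> homotopic_paths S p q"
  unfolding path_class_def using assms
  by (auto intro: homotopic_paths_trans homotopic_paths_sym)

text \<open>The product is a union over all pairs of representatives, and every pair contributes the
  same class.\<close>

lemma path_class_mult:
  assumes "loop_in S x p" "loop_in S x q"
  shows "path_class S p \<otimes>\<^bsub>fundamental_group S x\<^esub> path_class S q = path_class S (p +++ q)"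
proof -
  have "path_class S (p' +++ q') = path_class S (p +++ q)"
    if "p' \<in> path_class S p" "q' \<in> path_class S q" for p' q'
  proof -
    have "homotopic_paths S (p +++ q) (p' +++ q')"
      using that assms by (intro homotopic_paths_join) (auto simp: path_class_def loop_in_def)
    then show ?thesis
      using homotopic_paths_imp_path[of S "p +++ q"] homotopic_paths_imp_subset[of S "p +++ q"]
        path_class_eq_iff[of "p +++ q" S] by metis
  qed
  then have eq: "\<And>p' q'. p' \<in> path_class S p \<Longrightarrow> q' \<in> path_class S q \<Longrightarrow> path_class S (p' +++ q') = path_class S (p +++ q)"
    by blast
  have p: "p \<in> path_class S p" and q: "q \<in> path_class S q"
    using assms by (simp_all add: path_class_def loop_in_def)
  have "(\<Union>q'\<in>path_class S q. path_class S (p' +++ q')) = path_class S (p +++ q)" if "p' \<in> path_class S p" for p'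
    using eq[OF that] by (intro UN_constant_eq[OF q]) simp
  then have "(\<Union>p'\<in>path_class S p. \<Union>q'\<in>path_class S q. path_class S (p' +++ q')) = path_class S (p +++ q)"
    by (intro UN_constant_eq[OF p]) simp
  then show ?thesis
    by (simp add: fundamental_group_def)
qed

text \<open>\<open>W\<close> is a complete additive homotopy invariant of loops, so the fundamental
  group is its image. The image is a subgroup because reversal negates \<open>W\<close>, the
  multiples of unit vectors give it full rank, and coordinates in a basis are the
  isomorphism.\<close>

lemma fundamental_group_iso_int_power:
  fixes W :: "(real \<Rightarrow> 'a::topological_space) \<Rightarrow> nat \<Rightarrow> int"
  assumes homotopic: "\<And>p q. loop_in S x p \<Longrightarrow> loop_in S x q \<Longrightarrow> homotopic_paths S p q \<longleftrightarrow> (\<forall>i<k. W p i = W q i)"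
    and join: "\<And>p q i. loop_in S x p \<Longrightarrow> loop_in S x q \<Longrightarrow> i < k \<Longrightarrow> W (p +++ q) i = W p i + W q i"
    and multiples: "\<And>i. i < k \<Longrightarrow> \<exists>p N. loop_in S x p \<and> N > 0 \<and> (\<forall>j<k. W p j = (if j = i then N else 0))"
    and "x \<in> S"
  shows "fundamental_group S x \<cong> int_power_group k"
proof -
  \<comment> \<open>Entries from \<open>k\<close> on are set to 0, as the lattice lemma
    requires.\<close>
  define w where "w p = (\<lambda>i. if i < k then W p i else 0)" for p
  define H where "H = {w p | p. loop_in S x p}"
  have w_eq: "w p = w q \<longleftrightarrow> homotopic_paths S p q" if "loop_in S x p" "loop_in S x q" for p q
    using homotopic[OF that] by (auto simp: w_def fun_eq_iff)
  have wH: "w p \<in> H" if "loop_in S x p" for p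
    using that by (auto simp: H_def)
  have loop_join: "loop_in S x (p +++ q)" if "loop_in S x p" "loop_in S x q" for p q
    using that by (auto simp: loop_in_def path_image_join)
  have w_join: "w (p +++ q) = (\<lambda>i. w p i + w q i)" if "loop_in S x p" "loop_in S x q" for p q
    using join[OF that] by (auto simp: w_def)
  have const: "loop_in S x (\<lambda>_. x)"
    using \<open>x \<in> S\<close> by (auto simp: loop_in_def path_def path_image_def pathstart_def pathfinish_def)
  have w_const: "w (\<lambda>_. x) = (\<lambda>_. 0)"
  proof -
    \<comment> \<open>The constant loop is idempotent up to homotopy, so its value equals its own
      double.\<close>
    have "w ((\<lambda>_. x) +++ (\<lambda>_. x)) = w (\<lambda>_. x)"
      using const w_eq[OF loop_join[OF const const] const] by (auto simp: loop_in_def intro!: homotopic_paths_rid_const)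
    then show ?thesis
      using w_join[OF const const] by (simp add: fun_eq_iff)
  qed
  have rev: "loop_in S x (reversepath p)" "w (reversepath p) = (\<lambda>i. - w p i)" if "loop_in S x p" for p
  proof -
    show r: "loop_in S x (reversepath p)"
      using that by (auto simp: loop_in_def)
    have "w (p +++ reversepath p) = w (\<lambda>_. x)"
      using that w_eq[OF loop_join[OF that r] const] by (auto simp: loop_in_def intro!: homotopic_paths_rinv_const)
    then show "w (reversepath p) = (\<lambda>i. - w p i)"
      using w_join[OF that r] w_const by (simp add: fun_eq_iff add_eq_0_iff)
  qed
  have "\<exists>b. lattice_basis k H b"
  proof (rule ex_lattice_basis)
    show "f i = 0" if "f \<in> H" "k \<le> i" for f i
      using that by (auto simp: H_def w_def)
    show "(\<lambda>_. 0) \<in> H"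
      using wH[OF const] w_const by simp
    show "\<exists>N>0. (\<lambda>j. if j = i then N else 0) \<in> H" if "i < k" for i
    proof -
      obtain p N where p: "loop_in S x p" "N > 0" "\<forall>j<k. W p j = (if j = i then N else 0)"
        using multiples[OF \<open>i < k\<close>] by blast
      then have "w p = (\<lambda>j. if j = i then N else 0)"
        using that by (auto simp: w_def)
      then show ?thesis
        using p(2) wH[OF p(1)] by auto
    qed
    show "(\<lambda>i. f i - g i) \<in> H" if fg: "f \<in> H" "g \<in> H" for f g
    proof -
      obtain p q where pq: "loop_in S x p" "f = w p" "loop_in S x q" "g = w q"
        using fg unfolding H_def by blast
      have "(\<lambda>i. f i - g i) = w (p +++ reversepath q)"
        using w_join[OF pq(1) rev(1)[OF pq(3)]] rev(2)[OF pq(3)] pq by simp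
      then show ?thesis
        using wH[OF loop_join[OF pq(1) rev(1)[OF pq(3)]]] by simp
    qed
  qed
  then obtain b where basis: "lattice_basis k H b"
    by blast
  have b: "(\<lambda>j. \<Sum>i<k. c i * b i j) \<in> H" for c
    using basis unfolding lattice_basis_def by blast
  have ex1: "\<exists>!c. c \<in> {..<k} \<rightarrow>\<^sub>E UNIV \<and> f = (\<lambda>j. \<Sum>i<k. c i * b i j)" if "f \<in> H" for f
    using basis that unfolding lattice_basis_def by (elim conjE) (erule (1) bspec)
  define co where "co f = (THE c. c \<in> {..<k} \<rightarrow>\<^sub>E UNIV \<and> f = (\<lambda>j. \<Sum>i<k. c i * b i j))" for f
  have co_conj: "co f \<in> {..<k} \<rightarrow>\<^sub>E UNIV \<and> f = (\<lambda>j. \<Sum>i<k. co f i * b i j)" if "f \<in> H" for f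
    unfolding co_def by (rule theI'[OF ex1[OF that]])
  note co = conjunct1[OF co_conj] conjunct2[OF co_conj]
  have co_unique: "c = co f" if "f \<in> H" "c \<in> {..<k} \<rightarrow>\<^sub>E UNIV" "f = (\<lambda>j. \<Sum>i<k. c i * b i j)" for c f
    unfolding co_def using ex1[OF that(1)] that(2,3) by (intro the1_equality[symmetric] conjI)
  \<comment> \<open>The choice is harmless: all loops in a class are homotopic and share the same
    \<open>w\<close>.\<close>
  define \<Phi> where "\<Phi> A = co (w (SOME p. p \<in> A \<and> loop_in S x p))" for A
  have \<Phi>: "\<Phi> (path_class S p) = co (w p)" if p: "loop_in S x p" for p
  proof -
    have "p \<in> path_class S p \<and> loop_in S x p"
      using p by (auto simp: path_class_def loop_in_def)
    from someI[of "\<lambda>q. q \<in> path_class S p \<and> loop_in S x q", OF this]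
    have "homotopic_paths S p (SOME q. q \<in> path_class S p \<and> loop_in S x q)"
      "loop_in S x (SOME q. q \<in> path_class S p \<and> loop_in S x q)"
      by (auto simp: path_class_def)
    then have "w p = w (SOME q. q \<in> path_class S p \<and> loop_in S x q)"
      using w_eq[OF p] by blast
    then show ?thesis
      by (simp add: \<Phi>_def)
  qed
  have carrier: "carrier (fundamental_group S x) = path_class S ` {p. loop_in S x p}"
    by (auto simp: fundamental_group_def loop_in_def)
  have carrier_int: "carrier (int_power_group k) = {..<k} \<rightarrow>\<^sub>E UNIV"
    by (simp add: int_power_group_def)
  have \<Phi>_carrier: "\<Phi> A \<in> carrier (int_power_group k)" if A: "A \<in> carrier (fundamental_group S x)" for A
  proof -
    obtain p where p: "loop_in S x p" "A = path_class S p"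
      using A unfolding carrier by blast
    show ?thesis
      unfolding p(2) \<Phi>[OF p(1)] carrier_int by (rule co(1)[OF wH[OF p(1)]])
  qed
  have "\<Phi> \<in> iso (fundamental_group S x) (int_power_group k)"
    unfolding iso_def hom_def
  proof (intro CollectI conjI funcsetI ballI)
    show "\<Phi> A \<in> carrier (int_power_group k)" if "A \<in> carrier (fundamental_group S x)" for A
      using that by (rule \<Phi>_carrier)
  next
    fix A B assume "A \<in> carrier (fundamental_group S x)" "B \<in> carrier (fundamental_group S x)"
    then obtain p q where p: "loop_in S x p" "A = path_class S p" and q: "loop_in S x q" "B = path_class S q"
      unfolding carrier by blast
    have "(\<lambda>i\<in>{..<k}. co (w p) i + co (w q) i) = co (w (p +++ q))"
    proof (rule co_unique[OF wH[OF loop_join[OF p(1) q(1)]]])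
      have "w (p +++ q) j = (\<Sum>i<k. co (w p) i * b i j) + (\<Sum>i<k. co (w q) i * b i j)" for j
        using w_join[OF p(1) q(1)] fun_cong[OF co(2)[OF wH[OF p(1)]], of j] fun_cong[OF co(2)[OF wH[OF q(1)]], of j] by simp
      then show "w (p +++ q) = (\<lambda>j. \<Sum>i<k. (\<lambda>i\<in>{..<k}. co (w p) i + co (w q) i) i * b i j)"
        by (simp add: distrib_right sum.distrib fun_eq_iff)
    qed auto
    then show "\<Phi> (A \<otimes>\<^bsub>fundamental_group S x\<^esub> B) = \<Phi> A \<otimes>\<^bsub>int_power_group k\<^esub> \<Phi> B"
      using p q \<Phi> path_class_mult[OF p(1) q(1)] loop_join[OF p(1) q(1)]
      by (simp add: int_power_group_def)
  next
    have "inj_on \<Phi> (carrier (fundamental_group S x))"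
    proof (rule inj_onI)
      fix A B assume "A \<in> carrier (fundamental_group S x)" "B \<in> carrier (fundamental_group S x)" and eq: "\<Phi> A = \<Phi> B"
      then obtain p q where p: "loop_in S x p" "A = path_class S p" and q: "loop_in S x q" "B = path_class S q"
        unfolding carrier by blast
      then have "w p = w q"
        using eq \<Phi> co(2)[OF wH[OF p(1)]] co(2)[OF wH[OF q(1)]] by simp
      then show "A = B"
        using w_eq p q path_class_eq_iff[of p S q] by (auto simp: loop_in_def)
    qed
    moreover have "c \<in> \<Phi> ` carrier (fundamental_group S x)" if "c \<in> carrier (int_power_group k)" for c
    proof -
      obtain p where p: "loop_in S x p" "(\<lambda>j. \<Sum>i<k. c i * b i j) = w p"
        using b[of c] unfolding H_def by blast
      then have "\<Phi> (path_class S p) = c"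
        using co_unique[OF wH[OF p(1)], of c] that \<Phi> unfolding carrier_int by simp
      then show ?thesis
        unfolding carrier using p(1) by blast
    qed
    ultimately show "bij_betw \<Phi> (carrier (fundamental_group S x)) (carrier (int_power_group k))"
      using \<Phi>_carrier unfolding bij_betw_def by blast
  qed
  then show ?thesis
    by (auto simp: is_iso_def)
qed

section \<open>Words in translations\<close>

text \<open>The letter \<open>(a, b)\<close> stands for the translation by \<open>e\<^sub>a - e\<^sub>b\<close>. The rules are the edge-path
  relations that come from the triangles with vertices \<open>p, p + e\<^sub>a - e\<^sub>b, p + e\<^sub>a - e\<^sub>c\<close> and
  \<open>p, p + e\<^sub>b - e\<^sub>c, p + e\<^sub>a - e\<^sub>c\<close>.\<close>

inductive word_eq :: "'c set \<Rightarrow> ('c \<times> 'c) list \<Rightarrow> ('c \<times> 'c) list \<Rightarrow> bool" for K where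
  refl: "set w \<subseteq> K \<times> K \<Longrightarrow> word_eq K w w"
| sym: "word_eq K w w' \<Longrightarrow> word_eq K w' w"
| trans: "word_eq K w w' \<Longrightarrow> word_eq K w' w'' \<Longrightarrow> word_eq K w w''"
| fuse1: "set (r @ [(a, b), (b, c)] @ q) \<subseteq> K \<times> K \<Longrightarrow> word_eq K (r @ [(a, b), (b, c)] @ q) (r @ [(a, c)] @ q)"
| fuse2: "set (r @ [(b, c), (a, b)] @ q) \<subseteq> K \<times> K \<Longrightarrow> word_eq K (r @ [(b, c), (a, b)] @ q) (r @ [(a, c)] @ q)"
| drop: "set (r @ [(a, a)] @ q) \<subseteq> K \<times> K \<Longrightarrow> word_eq K (r @ [(a, a)] @ q) (r @ q)"

declare word_eq.trans [trans]

definition word_sum :: "('c \<times> 'c) list \<Rightarrow> 'c \<Rightarrow> int" where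
  "word_sum w i = (\<Sum>(a, b)\<leftarrow>w. of_bool (a = i) - of_bool (b = i))"

lemma word_sum_simps [simp]:
  "word_sum [] i = 0"
  "word_sum ((a, b) # w) i = of_bool (a = i) - of_bool (b = i) + word_sum w i"
  "word_sum (w @ w') i = word_sum w i + word_sum w' i"
  by (simp_all add: word_sum_def)

text \<open>Each letter has total 0. This later recovers the one coordinate that the invariant
  omits.\<close>

lemma word_sum_total:
  assumes "finite K" "set w \<subseteq> K \<times> K"
  shows "(\<Sum>i\<in>K. word_sum w i) = 0"
  using assms(2) by (induction w) (auto simp: sum.distrib sum_subtractf assms(1))

lemma word_sum_outside: "set w \<subseteq> K \<times> K \<Longrightarrow> i \<notin> K \<Longrightarrow> word_sum w i = 0"
  by (induction w) auto

lemma word_eq_context: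
  "word_eq K w w' \<Longrightarrow> set r \<subseteq> K \<times> K \<Longrightarrow> set q \<subseteq> K \<times> K \<Longrightarrow> word_eq K (r @ w @ q) (r @ w' @ q)"
proof (induction rule: word_eq.induct)
  case (fuse1 r' a b c q')
  then show ?case
    using word_eq.fuse1[of "r @ r'" a b c "q' @ q" K] by simp
next
  case (fuse2 r' b c a q')
  then show ?case
    using word_eq.fuse2[of "r @ r'" b c a "q' @ q" K] by simp
next
  case (drop r' a q')
  then show ?case
    using word_eq.drop[of "r @ r'" a "q' @ q" K] by simp
next
  case (refl w)
  then show ?case
    by (intro word_eq.refl) auto
qed (auto intro: word_eq.sym word_eq.trans)

text \<open>One fusion rule splits the first letter, the other fuses the new neighbor with
  \<open>(c, b)\<close>. Swapping the roles of the two rules produces the same two letters in the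
  opposite order.\<close>

lemma word_eq_exchange:
  assumes K: "a \<in> K" "b \<in> K" "c \<in> K" "d \<in> K"
  shows "word_eq K [(a, d), (c, b)] [(a, b), (c, d)]" and "word_eq K [(a, d), (c, b)] [(c, d), (a, b)]"
proof -
  have "word_eq K [(a, d), (c, b)] [(a, b), (b, d), (c, b)]"
    using word_eq.sym[OF word_eq.fuse1[of "[]" a b d "[(c, b)]" K]] K by simp
  also have "word_eq K \<dots> [(a, b), (c, d)]"
    using word_eq.fuse2[of "[(a, b)]" b d c "[]" K] K by simp
  finally show "word_eq K [(a, d), (c, b)] [(a, b), (c, d)]" .
  have "word_eq K [(a, d), (c, b)] [(c, d), (a, c), (c, b)]"
    using word_eq.sym[OF word_eq.fuse2[of "[]" c d a "[(c, b)]" K]] K by simp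
  also have "word_eq K \<dots> [(c, d), (a, b)]"
    using word_eq.fuse1[of "[(c, d)]" a c b "[]" K] K by simp
  finally show "word_eq K [(a, d), (c, b)] [(c, d), (a, b)]" .
qed

text \<open>The second components are exchanged twice, once keeping and once reversing the order of
  the letters.\<close>

lemma word_eq_commute:
  assumes "a \<in> K" "b \<in> K" "c \<in> K" "d \<in> K"
  shows "word_eq K [(a, d), (c, b)] [(c, b), (a, d)]"
  using word_eq_exchange(1)[of a K b c d] word_eq_exchange(2)[of a K d c b] assms
  by (blast intro: word_eq.trans)

lemma word_eq_move:
  assumes "x \<in> K \<times> K" "set u \<subseteq> K \<times> K"
  shows "word_eq K (u @ [x]) (x # u)"
  using assms(2)
proof (induction u)
  case Nil
  then show ?case
    using assms(1) by (auto intro: word_eq.refl)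
next
  case (Cons y u)
  obtain a b c d where xy: "x = (c, b)" "y = (a, d)"
    by (cases x, cases y)
  have "word_eq K ((y # u) @ [x]) (y # x # u)"
    using word_eq_context[OF Cons.IH, of "[y]" "[]"] Cons.prems by simp
  also have "word_eq K \<dots> (x # y # u)"
    using word_eq_context[OF word_eq_commute[of a K b c d], of "[]" u] Cons.prems assms(1) by (simp add: xy)
  finally show ?case .
qed

lemma zero_word_sum_letter:
  assumes "word_sum w i < 0"
  obtains u c v where "w = u @ [(c, i)] @ v"
proof -
  have "\<exists>c. (c, i) \<in> set w"
    using assms by (induction w) (auto split: if_splits simp: of_bool_def)
  then show thesis
    using that by (metis append_Cons append_Nil split_list)
qed

text \<open>Induction on the length. A nontrivial first letter \<open>(a, b)\<close> contributes 1
  at \<open>a\<close>, so a later letter \<open>(c, a)\<close> must compensate it; moved to the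
  front, it fuses with \<open>(a, b)\<close> into the single letter \<open>(c, b)\<close>.\<close>

lemma word_eq_Nil:
  assumes "set w \<subseteq> K \<times> K" "\<And>i. word_sum w i = 0"
  shows "word_eq K w []"
  using assms
proof (induction "length w" arbitrary: w rule: less_induct)
  case less
  show ?case
  proof (cases w)
    case Nil
    then show ?thesis
      by (simp add: word_eq.refl)
  next
    case (Cons x w')
    then obtain a b where w: "w = (a, b) # w'"
      by (cases x) auto
    show ?thesis
    proof (cases "a = b")
      case True
      have "word_eq K w w'"
        using word_eq.drop[of "[]" a w' K] less.prems(1) True by (simp add: w)
      moreover have "word_eq K w' []"
        using less.hyps[of w'] less.prems True by (auto simp: w)
      ultimately show ?thesis
        by (rule word_eq.trans)
    next
      case False
      have "word_sum w' a < 0"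
        using less.prems(2)[of a] False by (simp add: w)
      then obtain u c v where w': "w' = u @ [(c, a)] @ v"
        by (rule zero_word_sum_letter)
      have K: "a \<in> K" "b \<in> K" "c \<in> K" "set u \<subseteq> K \<times> K" "set v \<subseteq> K \<times> K"
        using less.prems(1) by (auto simp: w w')
      have "word_eq K w ((c, a) # ((a, b) # u) @ v)"
        using word_eq_context[OF word_eq_move[of "(c, a)" K "(a, b) # u"], of "[]" v] K by (simp add: w w')
      also have "word_eq K \<dots> ((c, b) # u @ v)"
        using word_eq.fuse1[of "[]" c a b "u @ v" K] K by simp
      also have "word_eq K \<dots> []"
      proof (rule less.hyps)
        show "word_sum ((c, b) # u @ v) i = 0" for i
          using less.prems(2)[of i] by (simp add: w w')
      qed (use K in \<open>auto simp: w w'\<close>)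
      finally show ?thesis .
    qed
  qed
qed

lemma word_eq_if_same_sum:
  assumes "set w \<subseteq> K \<times> K" "set w' \<subseteq> K \<times> K" "\<And>i. word_sum w i = word_sum w' i"
  shows "word_eq K w w'"
proof -
  \<comment> \<open>The letters are inverted but keep their order, which is enough because only sums
    enter.\<close>
  define v where "v = map (\<lambda>(a, b). (b, a)) w'"
  have v: "set v \<subseteq> K \<times> K"
    using assms(2) by (auto simp: v_def)
  have sum_v: "word_sum v i = - word_sum w' i" for i
    unfolding v_def by (induction w') auto
  have "word_eq K w (w @ v @ w')"
    using word_eq_context[OF word_eq.sym[OF word_eq_Nil[of "v @ w'" K]], of w "[]"] v assms(1,2) sum_v by simp
  also have "word_eq K (w @ v @ w') w'"
    using word_eq_context[OF word_eq_Nil[of "w @ v" K], of "[]" w'] v assms sum_v by simp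
  finally show ?thesis .
qed

section \<open>Walks and the points they visit\<close>

fun walk :: "('c \<Rightarrow> 'c \<Rightarrow> 'p \<Rightarrow> 'p) \<Rightarrow> 'p \<Rightarrow> ('c \<times> 'c) list \<Rightarrow> 'p" where
  "walk s p [] = p"
| "walk s p ((a, b) # w) = walk s (s a b p) w"

fun trail :: "('c \<Rightarrow> 'c \<Rightarrow> 'p \<Rightarrow> 'p) \<Rightarrow> 'p \<Rightarrow> ('c \<times> 'c) list \<Rightarrow> 'p list" where
  "trail s p [] = [p]"
| "trail s p ((a, b) # w) = p # trail s (s a b p) w"

lemma walk_append: "walk s p (w @ w') = walk s (walk s p w) w'"
  by (induction w arbitrary: p) auto

lemma trail_nonempty [simp]: "trail s p w \<noteq> []"
  by (induction w arbitrary: p) auto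

text \<open>The second trail starts where the first one ends; \<open>butlast\<close> avoids listing
  that point twice.\<close>

lemma trail_append: "trail s p (w @ w') = butlast (trail s p w) @ trail s (walk s p w) w'"
  by (induction w arbitrary: p) auto

lemma hd_trail [simp]: "hd (trail s p w) = p"
  by (cases w) (auto split: prod.splits)

lemma last_trail [simp]: "last (trail s p w) = walk s p w"
  by (induction w arbitrary: p) auto

lemma trail_snoc: "trail s p (w @ [(a, b)]) = trail s p w @ [s a b (walk s p w)]"
  by (induction w arbitrary: p) auto

section \<open>Complexes with a translation structure\<close>

text \<open>\<open>s a b p\<close> plays the role of \<open>p + e\<^sub>a - e\<^sub>b\<close>. The facets are the simplices
  \<open>{p + e\<^sub>a - e\<^sub>c | c}\<close> and \<open>{p + e\<^sub>c - e\<^sub>a | c}\<close>.\<close>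

locale translation_structure =
  fixes k :: nat and P :: "'p set" and s :: "nat \<Rightarrow> nat \<Rightarrow> 'p \<Rightarrow> 'p"
  assumes finite_P: "finite P"
    and s_closed: "\<And>p a b. p \<in> P \<Longrightarrow> a \<in> {1..k + 1} \<Longrightarrow> b \<in> {1..k + 1} \<Longrightarrow> s a b p \<in> P"
    and s_same: "\<And>p a. p \<in> P \<Longrightarrow> a \<in> {1..k + 1} \<Longrightarrow> s a a p = p"
    and s_fuse1: "\<And>p a b c. p \<in> P \<Longrightarrow> a \<in> {1..k + 1} \<Longrightarrow> b \<in> {1..k + 1} \<Longrightarrow> c \<in> {1..k + 1} \<Longrightarrow>
      s b c (s a b p) = s a c p"
    and s_fuse2: "\<And>p a b c. p \<in> P \<Longrightarrow> a \<in> {1..k + 1} \<Longrightarrow> b \<in> {1..k + 1} \<Longrightarrow> c \<in> {1..k + 1} \<Longrightarrow>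
      s a b (s b c p) = s a c p"
    and s_inj: "\<And>p a b c d. p \<in> P \<Longrightarrow> a \<in> {1..k + 1} \<Longrightarrow> b \<in> {1..k + 1} \<Longrightarrow> c \<in> {1..k + 1} \<Longrightarrow>
      d \<in> {1..k + 1} \<Longrightarrow> s a b p = s c d p \<Longrightarrow> a = b \<and> c = d \<or> a = c \<and> b = d"
    and s_transitive: "\<And>p q. p \<in> P \<Longrightarrow> q \<in> P \<Longrightarrow> \<exists>w. set w \<subseteq> {1..k + 1} \<times> {1..k + 1} \<and> walk s p w = q"
begin

abbreviation K :: "nat set" where "K \<equiv> {1..k + 1}"

definition upper :: "'p \<Rightarrow> nat \<Rightarrow> 'p set" where
  "upper p a = (\<lambda>c. s a c p) ` K"

definition lower :: "'p \<Rightarrow> nat \<Rightarrow> 'p set" where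
  "lower p a = (\<lambda>c. s c a p) ` K"

definition X :: "'p set set" where
  "X = {\<sigma>. \<sigma> \<noteq> {} \<and> (\<exists>p\<in>P. \<exists>a\<in>K. \<sigma> \<subseteq> upper p a \<or> \<sigma> \<subseteq> lower p a)}"

lemma walk_closed: "p \<in> P \<Longrightarrow> set w \<subseteq> K \<times> K \<Longrightarrow> walk s p w \<in> P"
  by (induction w arbitrary: p) (auto simp: s_closed)

lemma upper_subset: "p \<in> P \<Longrightarrow> a \<in> K \<Longrightarrow> upper p a \<subseteq> P"
  and lower_subset: "p \<in> P \<Longrightarrow> a \<in> K \<Longrightarrow> lower p a \<subseteq> P"
  unfolding upper_def lower_def using s_closed by blast+

lemma face_subset_P: "\<sigma> \<in> X \<Longrightarrow> \<sigma> \<subseteq> P"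
  unfolding X_def using upper_subset lower_subset by blast

lemma X_I:
  assumes "\<sigma> \<noteq> {}" "p \<in> P" "a \<in> K" "\<sigma> \<subseteq> upper p a \<or> \<sigma> \<subseteq> lower p a"
  shows "\<sigma> \<in> X"
  unfolding X_def using assms by blast

lemma finite_complex_X: "finite_complex X"
proof -
  have "X \<subseteq> Pow P"
    using face_subset_P by blast
  then have "finite X" "\<forall>\<sigma>\<in>X. finite \<sigma>"
    using finite_P by (auto intro: finite_subset)
  moreover have "\<tau> \<in> X" if "\<sigma> \<in> X" "\<tau> \<subseteq> \<sigma>" "\<tau> \<noteq> {}" for \<sigma> \<tau>
  proof -
    obtain p a where "p \<in> P" "a \<in> K" "\<sigma> \<subseteq> upper p a \<or> \<sigma> \<subseteq> lower p a"
      using \<open>\<sigma> \<in> X\<close> unfolding X_def by blast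
    then show ?thesis
      using that by (intro X_I[of \<tau> p a]) blast+
  qed
  moreover have "{} \<notin> X"
    by (simp add: X_def)
  ultimately show ?thesis
    unfolding finite_complex_def by blast
qed

sublocale simplicial_complex X
  by unfold_locales (rule finite_complex_X)

lemma upperI: "c \<in> K \<Longrightarrow> q = s a c p \<Longrightarrow> q \<in> upper p a"
  and lowerI: "c \<in> K \<Longrightarrow> q = s c a p \<Longrightarrow> q \<in> lower p a"
  by (auto simp: upper_def lower_def)

text \<open>Because \<open>p = s a a p\<close>, the three vertices lie in \<open>upper p a\<close>;
  those of \<open>triangle2\<close> lie in \<open>lower p c\<close>. The two triangles realize the
  rules \<open>fuse1\<close> and \<open>fuse2\<close>.\<close>

lemma triangle1:
  assumes "p \<in> P" "a \<in> K" "b \<in> K" "c \<in> K"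
  shows "{p, s a b p, s a c p} \<in> X"
  using assms s_same[of p a] by (intro X_I[of _ p a] disjI1) (auto intro: upperI)

lemma triangle2:
  assumes "p \<in> P" "a \<in> K" "b \<in> K" "c \<in> K"
  shows "{p, s b c p, s a c p} \<in> X"
  using assms s_same[of p c] by (intro X_I[of _ p c] disjI2) (auto intro: lowerI)

lemma edge: "p \<in> P \<Longrightarrow> a \<in> K \<Longrightarrow> b \<in> K \<Longrightarrow> {p, s a b p} \<in> X"
  using triangle1[of p a b b] by simp

lemma singleton: "p \<in> P \<Longrightarrow> {p} \<in> X"
  using edge[of p 1 1] s_same[of p 1] by simp

lemma vertex_R: "p \<in> P \<Longrightarrow> vertex p \<in> R"
  by (intro vertex_in_realization singleton)

text \<open>Labelling the vertex \<open>p + e_a - e_c\<close> of \<open>upper p a\<close> by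
  \<open>c\<close>, the difference of two vertices depends on their labels only. For
  \<open>p + e_c - e_a\<close> in \<open>lower p a\<close> the sign is reversed, hence the two
  alternatives.\<close>

lemma face_potential_aux:
  assumes "\<sigma> \<in> X"
  shows "\<exists>c :: 'p \<Rightarrow> nat. (\<forall>u\<in>\<sigma>. c u \<in> K) \<and>
    ((\<forall>u\<in>\<sigma>. \<forall>w\<in>\<sigma>. w = s (c u) (c w) u) \<or> (\<forall>u\<in>\<sigma>. \<forall>w\<in>\<sigma>. w = s (c w) (c u) u))"
proof -
  obtain p a where p: "p \<in> P" "a \<in> K" and sub: "\<sigma> \<subseteq> upper p a \<or> \<sigma> \<subseteq> lower p a"
    using assms unfolding X_def by blast
  from sub show ?thesis
  proof
    assume "\<sigma> \<subseteq> upper p a"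
    then have "\<forall>u\<in>\<sigma>. \<exists>c\<in>K. u = s a c p"
      unfolding upper_def by blast
    then obtain c where c: "\<And>u. u \<in> \<sigma> \<Longrightarrow> c u \<in> K" "\<And>u. u \<in> \<sigma> \<Longrightarrow> u = s a (c u) p"
      by metis
    have "w = s (c u) (c w) u" if "u \<in> \<sigma>" "w \<in> \<sigma>" for u w
      using s_fuse1[OF p c(1)[OF that(1)] c(1)[OF that(2)]] c(2)[OF that(1)] c(2)[OF that(2)] by simp
    then show ?thesis
      using c(1) by blast
  next
    assume "\<sigma> \<subseteq> lower p a"
    then have "\<forall>u\<in>\<sigma>. \<exists>c\<in>K. u = s c a p"
      unfolding lower_def by blast
    then obtain c where c: "\<And>u. u \<in> \<sigma> \<Longrightarrow> c u \<in> K" "\<And>u. u \<in> \<sigma> \<Longrightarrow> u = s (c u) a p"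
      by metis
    have "w = s (c w) (c u) u" if "u \<in> \<sigma>" "w \<in> \<sigma>" for u w
      using s_fuse2[OF p(1) c(1)[OF that(2)] c(1)[OF that(1)] p(2)] c(2)[OF that(1)] c(2)[OF that(2)] by simp
    then show ?thesis
      using c(1) by blast
  qed
qed

section \<open>Displacements between adjacent vertices\<close>

lemma adjacent:
  assumes "u \<in> \<sigma>" "w \<in> \<sigma>" "\<sigma> \<in> X"
  obtains a b where "a \<in> K" "b \<in> K" "w = s a b u"
  using face_potential_aux[OF assms(3)] assms(1,2) by blast

text \<open>The description picks the vector and not a letter: for \<open>u = w\<close> every letter
  \<open>(a, a)\<close> fits, but all of these have sum 0.\<close>

definition displacement :: "'p \<Rightarrow> 'p \<Rightarrow> nat \<Rightarrow> int" where
  "displacement u w = (THE d. \<exists>a\<in>K. \<exists>b\<in>K. w = s a b u \<and> d = word_sum [(a, b)])"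

lemma displacement_s:
  assumes "p \<in> P" "a \<in> K" "b \<in> K"
  shows "displacement p (s a b p) i = word_sum [(a, b)] i"
proof -
  have "displacement p (s a b p) = word_sum [(a, b)]"
    unfolding displacement_def
  proof (rule the_equality)
    show "\<exists>a'\<in>K. \<exists>b'\<in>K. s a b p = s a' b' p \<and> word_sum [(a, b)] = word_sum [(a', b')]"
      using assms by blast
  next
    fix d assume "\<exists>a'\<in>K. \<exists>b'\<in>K. s a b p = s a' b' p \<and> d = word_sum [(a', b')]"
    then obtain a' b' where *: "a' \<in> K" "b' \<in> K" "s a b p = s a' b' p" "d = word_sum [(a', b')]"
      by blast
    then show "d = word_sum [(a, b)]"
      using s_inj[OF assms *(1,2,3)] by (auto simp: fun_eq_iff)
  qed
  then show ?thesis
    by simp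
qed

text \<open>The potential is the unit vector of the label, up to sign. Hence measuring from another
  vertex of the face changes coordinates by an integer constant, which makes the circle maps well
  defined.\<close>

lemma face_potential:
  assumes "\<sigma> \<in> X"
  obtains \<phi> where "\<And>u w i. u \<in> \<sigma> \<Longrightarrow> w \<in> \<sigma> \<Longrightarrow> displacement u w i = \<phi> w i - \<phi> u i"
proof -
  obtain c :: "'p \<Rightarrow> nat" where K: "\<And>u. u \<in> \<sigma> \<Longrightarrow> c u \<in> K" and
    c: "(\<forall>u\<in>\<sigma>. \<forall>w\<in>\<sigma>. w = s (c u) (c w) u) \<or> (\<forall>u\<in>\<sigma>. \<forall>w\<in>\<sigma>. w = s (c w) (c u) u)"
    using face_potential_aux[OF assms] by blast
  have P: "u \<in> P" if "u \<in> \<sigma>" for u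
    using face_subset_P[OF assms] that by blast
  from c show thesis
  proof
    assume c: "\<forall>u\<in>\<sigma>. \<forall>w\<in>\<sigma>. w = s (c u) (c w) u"
    show thesis
    proof (rule that[of "\<lambda>u i. - of_bool (c u = i)"])
      fix u w i assume "u \<in> \<sigma>" "w \<in> \<sigma>"
      then show "displacement u w i = - of_bool (c w = i) - - of_bool (c u = i)"
        using displacement_s[OF P K K, of u u w i] c by simp
    qed
  next
    assume c: "\<forall>u\<in>\<sigma>. \<forall>w\<in>\<sigma>. w = s (c w) (c u) u"
    show thesis
    proof (rule that[of "\<lambda>u i. of_bool (c u = i)"])
      fix u w i assume "u \<in> \<sigma>" "w \<in> \<sigma>"
      then show "displacement u w i = of_bool (c w = i) - of_bool (c u = i)"
        using displacement_s[OF P K K, of u w u i] c by simp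
    qed
  qed
qed

subsection \<open>Homotopy of edge paths\<close>

lemma compatible_vertex: "compatible (vertex u) (vertex w) \<longleftrightarrow> {u, w} \<in> X"
  by (simp add: compatible_def insert_commute)

lemma polygon_trail:
  assumes "p \<in> P" "set w \<subseteq> K \<times> K" "polygon (xs @ [vertex p])" "polygon (vertex (walk s p w) # ys)"
  shows "polygon (xs @ map vertex (trail s p w) @ ys)"
proof -
  have "polygon (map vertex (trail s p w) @ ys)"
    using assms(1,2,4)
  proof (induction w arbitrary: p)
    case (Cons x w)
    obtain a b where x: "x = (a, b)"
      by (cases x)
    have K: "a \<in> K" "b \<in> K"
      using Cons.prems by (auto simp: x)
    have "polygon (map vertex (trail s (s a b p) w) @ ys)"
      using Cons.IH[of "s a b p"] Cons.prems K by (simp add: x s_closed)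
    moreover obtain us where "trail s (s a b p) w = s a b p # us"
      using hd_trail[of s "s a b p" w] trail_nonempty by (metis list.collapse)
    ultimately show ?case
      using edge[OF Cons.prems(1) K] vertex_R[OF Cons.prems(1)] by (simp add: x compatible_vertex)
  qed simp
  moreover obtain us where "trail s p w = p # us"
    using hd_trail[of s p w] trail_nonempty by (metis list.collapse)
  ultimately show ?thesis
    using assms(3) polygon_append[of xs "vertex p" "map vertex us @ ys"] by simp
qed

lemma word_eq_walk:
  "word_eq K w w' \<Longrightarrow> p \<in> P \<Longrightarrow> walk s p w = walk s p w'"
proof (induction rule: word_eq.induct)
  case (fuse1 r a b c q)
  then show ?case
    using s_fuse1[OF walk_closed[of p r]] by (simp add: walk_append)
next
  case (fuse2 r b c a q)
  then show ?case
    using s_fuse2[OF walk_closed[of p r]] by (simp add: walk_append)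
next
  case (drop r a q)
  then show ?case
    using s_same[OF walk_closed[of p r]] by (simp add: walk_append)
qed auto

lemma trail_eq_Cons: "\<exists>us. trail s p w = p # us"
  using hd_trail[of s p w] trail_nonempty by (metis list.collapse)

text \<open>Each rewriting rule erases the middle one of three consecutive points in a simplex. The
  tail \<open>y # ys\<close> is nonempty so that, in the case \<open>drop\<close>, a repeated vertex
  at the end of the trail still has a successor.\<close>

lemma word_eq_homotopic:
  assumes "word_eq K w w'" "p \<in> P" "polygon (xs @ [vertex p])" "polygon (vertex (walk s p w) # y # ys)"
  shows "homotopic_paths R (polygonal (xs @ map vertex (trail s p w) @ y # ys))
    (polygonal (xs @ map vertex (trail s p w') @ y # ys))"
  using assms(1,4)
proof (induction rule: word_eq.induct)
  case (refl w)
  then show ?case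
    using polygonal_path[OF polygon_trail[OF assms(2) refl(1) assms(3) refl(2)]] by simp
next
  case (sym w w')
  then show ?case
    using word_eq_walk[OF sym.hyps assms(2)] by (auto intro: homotopic_paths_sym)
next
  case (trans w w' w'')
  then show ?case
    using word_eq_walk[OF trans.hyps(1) assms(2)] by (auto intro: homotopic_paths_trans)
next
  case (fuse1 r a b c q)
  define u where "u = walk s p r"
  have K: "u \<in> P" "a \<in> K" "b \<in> K" "c \<in> K"
    using fuse1.hyps assms(2) by (auto simp: u_def walk_closed)
  obtain us where us: "trail s (s a c u) q = s a c u # us"
    using trail_eq_Cons by blast
  let ?xs = "xs @ map vertex (butlast (trail s p r))" and ?zs = "map vertex us @ y # ys"
  have l: "xs @ map vertex (trail s p (r @ [(a, b), (b, c)] @ q)) @ y # ys = ?xs @ [vertex u, vertex (s a b u), vertex (s a c u)] @ ?zs"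
    "xs @ map vertex (trail s p (r @ [(a, c)] @ q)) @ y # ys = ?xs @ [vertex u, vertex (s a c u)] @ ?zs"
    using s_fuse1[OF K] by (simp_all add: trail_append us flip: u_def)
  have "supp (vertex u) \<union> supp (vertex (s a b u)) \<union> supp (vertex (s a c u)) \<in> X"
    using triangle1[OF K] by (simp add: insert_commute)
  then show ?case
    using polygon_trail[OF assms(2) fuse1.hyps assms(3) fuse1.prems] unfolding l by (intro polygonal_remove_middle(2))
next
  case (fuse2 r b c a q)
  define u where "u = walk s p r"
  have K: "u \<in> P" "a \<in> K" "b \<in> K" "c \<in> K"
    using fuse2.hyps assms(2) by (auto simp: u_def walk_closed)
  obtain us where us: "trail s (s a c u) q = s a c u # us"
    using trail_eq_Cons by blast
  let ?xs = "xs @ map vertex (butlast (trail s p r))" and ?zs = "map vertex us @ y # ys"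
  have l: "xs @ map vertex (trail s p (r @ [(b, c), (a, b)] @ q)) @ y # ys = ?xs @ [vertex u, vertex (s b c u), vertex (s a c u)] @ ?zs"
    "xs @ map vertex (trail s p (r @ [(a, c)] @ q)) @ y # ys = ?xs @ [vertex u, vertex (s a c u)] @ ?zs"
    using s_fuse2[OF K] by (simp_all add: trail_append us flip: u_def)
  have "supp (vertex u) \<union> supp (vertex (s b c u)) \<union> supp (vertex (s a c u)) \<in> X"
    using triangle2[OF K] by (simp add: insert_commute)
  then show ?case
    using polygon_trail[OF assms(2) fuse2.hyps assms(3) fuse2.prems] unfolding l by (intro polygonal_remove_middle(2))
next
  case (drop r a q)
  define u where "u = walk s p r"
  have K: "u \<in> P" "a \<in> K"
    using drop.hyps assms(2) by (auto simp: u_def walk_closed)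
  obtain us where us: "trail s u q = u # us"
    using trail_eq_Cons by blast
  let ?xs = "xs @ map vertex (butlast (trail s p r))"
  obtain z zs where zs: "map vertex us @ y # ys = z # zs"
    by (cases "map vertex us @ y # ys") auto
  have l: "xs @ map vertex (trail s p (r @ [(a, a)] @ q)) @ y # ys = ?xs @ [vertex u, vertex u, z] @ zs"
    "xs @ map vertex (trail s p (r @ q)) @ y # ys = ?xs @ [vertex u, z] @ zs"
    using s_same[OF K] zs by (simp_all add: trail_append us flip: u_def)
  have pl: "polygon (?xs @ [vertex u, vertex u, z] @ zs)"
    using polygon_trail[OF assms(2) drop.hyps assms(3) drop.prems] unfolding l .
  then have "compatible (vertex u) z"
    using polygon_append[of ?xs "vertex u" "vertex u # z # zs"] by simp
  then have "supp (vertex u) \<union> supp (vertex u) \<union> supp z \<in> X"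
    by (simp add: compatible_def)
  then show ?case
    using pl unfolding l by (intro polygonal_remove_middle(2))
qed

text \<open>Points are pushed to vertices of their supports. The induction hypothesis starts at a
  vertex \<open>u\<close> of the support of \<open>y\<close>; then \<open>x, y, u\<close> contracts
  to \<open>x, u\<close>, which expands to \<open>x, v, u\<close>. Since \<open>v\<close> is
  arbitrary, successive steps fit together.\<close>

lemma polygonal_homotopic_trail:
  assumes "polygon xs" "v \<in> supp (hd xs)"
  shows "\<exists>w. set w \<subseteq> K \<times> K \<and> walk s v w \<in> supp (last xs) \<and>
    polygon (hd xs # map vertex (trail s v w) @ [last xs]) \<and>
    homotopic_paths R (polygonal xs) (polygonal (hd xs # map vertex (trail s v w) @ [last xs]))"
  using assms
proof (induction xs arbitrary: v rule: polygonal.induct)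
  case (2 x)
  have x: "x \<in> R" "supp x \<in> X"
    using 2 by (auto simp: realization_iff)
  have p: "polygon [x, vertex v, x]"
    using x 2 face_subset_P[OF x(2)] by (auto intro!: vertex_R simp: compatible_def insert_absorb)
  have "homotopic_paths R (polygonal [x, vertex v, x]) (polygonal [x, x])"
    using polygonal_remove_middle(2)[of "[]" x "vertex v" x "[]"] p x 2 by (simp add: insert_absorb)
  also have "homotopic_paths R (polygonal [x, x]) (polygonal [x])"
    using polygonal_path[of "[x]"] x by (auto simp: seg_same pathfinish_def intro!: homotopic_paths_rid_const)
  finally have "homotopic_paths R (polygonal [x]) (polygonal [x, vertex v, x])"
    by (rule homotopic_paths_sym)
  then show ?case
    using p 2 by (intro exI[of _ "[]"]) simp
next
  case (3 x y zs)
  have yR: "y \<in> R" and xR: "x \<in> R" and xy: "compatible x y"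
    using "3.prems"(1) by (auto simp: polygon_def)
  then obtain u where u: "u \<in> supp y"
    using supp_nonempty by blast
  obtain w' where w': "set w' \<subseteq> K \<times> K" "walk s u w' \<in> supp (last (y # zs))"
    and p': "polygon (y # map vertex (trail s u w') @ [last (y # zs)])"
    and h': "homotopic_paths R (polygonal (y # zs)) (polygonal (y # map vertex (trail s u w') @ [last (y # zs)]))"
    using "3.IH"[of u] "3.prems"(1) u by auto
  have \<sigma>: "supp x \<union> supp y \<in> X"
    using xy by (simp add: compatible_def)
  have v: "v \<in> supp x"
    using "3.prems" by simp
  have vP: "v \<in> P"
    using face_subset_P[OF \<sigma>] v by auto
  \<comment> \<open>Both vertices lie in the face spanned by \<open>x\<close> and \<open>y\<close>,
    so a single letter leads from \<open>v\<close> to \<open>u\<close>.\<close>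
  obtain a b where ab: "a \<in> K" "b \<in> K" "u = s a b v"
    using adjacent[of v _ u, OF _ _ \<sigma>] u v by blast
  obtain us where us: "trail s u w' = u # us"
    using trail_eq_Cons by blast
  let ?zs = "map vertex us @ [last (y # zs)]"
  have sub: "insert u (supp x \<union> supp y) \<in> X" "insert v (insert u (supp x)) \<in> X"
    using \<sigma> u v by (auto simp: insert_absorb intro: face_subset[OF \<sigma>])
  have "polygon ([] @ [x, y, vertex u] @ ?zs)"
    using p' xR xy by (simp add: us)
  note rem1 = polygonal_remove_middle[OF this]
  have eq: "supp x \<union> supp y \<union> supp (vertex u) = insert u (supp x \<union> supp y)"
    "supp x \<union> supp (vertex v) \<union> supp (vertex u) = insert v (insert u (supp x))"
    by auto
  have pxu: "polygon (x # vertex u # ?zs)" and h1: "homotopic_paths R (polygonal (x # y # vertex u # ?zs)) (polygonal (x # vertex u # ?zs))"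
    using rem1 sub(1) unfolding eq by simp_all
  have "compatible x (vertex v)"
    using v \<open>x \<in> R\<close> by (simp add: compatible_def insert_absorb realization_iff)
  then have p2: "polygon ([] @ [x, vertex v, vertex u] @ ?zs)"
    using pxu edge[OF vP ab(1,2)] vertex_R[OF vP] by (simp add: compatible_vertex ab(3))
  then have h2: "homotopic_paths R (polygonal (x # vertex v # vertex u # ?zs)) (polygonal (x # vertex u # ?zs))"
    using polygonal_remove_middle(2)[OF p2] sub(2) unfolding eq by simp
  have "homotopic_paths R (polygonal (x # y # zs)) (polygonal (x # y # vertex u # ?zs))"
    unfolding polygonal.simps(3)[of x y] using h' path_seg path_image_seg[OF xR yR xy]
    by (intro homotopic_paths_join) (auto simp: us)
  also note h1
  also note homotopic_paths_sym[OF h2]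
  finally show ?case
    using p2 w' ab(1,2) by (intro exI[of _ "(a, b) # w'"]) (simp add: us flip: ab(3))
qed simp

end

section \<open>Winding numbers and the fundamental group\<close>

lemma exp_2pi_int_shift:
  fixes x y :: real and m :: int
  assumes "x - y = of_int m"
  shows "exp (2 * of_real pi * \<i> * of_real x) = exp (2 * of_real pi * \<i> * of_real y)"
proof -
  have "x = y + of_int m"
    using assms by simp
  then have "2 * of_real pi * \<i> * of_real x = 2 * of_real pi * \<i> * of_real y + (2 * of_int m * of_real pi) * \<i>"
    by (simp add: algebra_simps)
  then show ?thesis
    using exp_integer_2pi[of "of_int m"] by (simp add: exp_add mult_ac)
qed

context translation_structure
begin

text \<open>The affine extension of the \<open>i\<close>-th lattice coordinate with origin
  \<open>v\<close>. Points outside the support have weight 0, so their displacements, possibly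
  unspecified, do not matter; the sum over the fixed set \<open>P\<close> makes the formula
  continuous in \<open>x\<close>.\<close>

definition coordinate :: "'p \<Rightarrow> nat \<Rightarrow> ('p \<Rightarrow> real) \<Rightarrow> real" where
  "coordinate v i x = (\<Sum>w\<in>P. x w * of_int (displacement v w i))"

text \<open>Affine coordinates of \<open>x\<close> relative to different vertices of a simplex differ by integers, so that
  their residues modulo 1 give maps from the realization to the circle.\<close>

definition circle_map :: "nat \<Rightarrow> ('p \<Rightarrow> real) \<Rightarrow> complex" where
  "circle_map i x = exp (2 * of_real pi * \<i> * of_real (coordinate (SOME v. v \<in> supp x) i x))"

definition winding :: "nat \<Rightarrow> (real \<Rightarrow> 'p \<Rightarrow> real) \<Rightarrow> complex" where
  "winding i g = winding_number (circle_map i \<circ> g) 0"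

text \<open>The weights sum to 1, so by the potential a change of origin adds an integer, which
  \<open>exp\<close> forgets. The origin may lie outside the support of \<open>x\<close>, so that
  one origin serves along a whole segment.\<close>

lemma circle_map_eq:
  assumes "x \<in> R" "insert v (supp x) \<in> X"
  shows "circle_map i x = exp (2 * of_real pi * \<i> * of_real (coordinate v i x))"
proof -
  define v0 where "v0 = (SOME v. v \<in> supp x)"
  have v0: "v0 \<in> supp x"
    unfolding v0_def using supp_nonempty[OF assms(1)] by (simp add: some_in_eq)
  obtain \<phi> where \<phi>: "\<And>u w i. u \<in> insert v (supp x) \<Longrightarrow> w \<in> insert v (supp x) \<Longrightarrow> displacement u w i = \<phi> w i - \<phi> u i"
    using face_potential[OF assms(2)] by blast
  have subP: "supp x \<subseteq> P"
    using face_subset_P[OF assms(2)] by auto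
  have "coordinate u i x = (\<Sum>w\<in>supp x. x w * of_int (\<phi> w i)) - of_int (\<phi> u i)" if u: "u \<in> insert v (supp x)" for u
  proof -
    have "coordinate u i x = (\<Sum>w\<in>supp x. x w * of_int (displacement u w i))"
      unfolding coordinate_def using subP finite_P by (intro sum.mono_neutral_right) (auto simp: supp_def)
    also have "\<dots> = (\<Sum>w\<in>supp x. x w * of_int (\<phi> w i) - x w * of_int (\<phi> u i))"
      by (intro sum.cong) (auto simp: \<phi>[OF u] right_diff_distrib)
    also have "\<dots> = (\<Sum>w\<in>supp x. x w * of_int (\<phi> w i)) - of_int (\<phi> u i)"
      using assms(1) by (simp add: sum_subtractf realization_iff flip: sum_distrib_right)
    finally show ?thesis .
  qed
  then have "coordinate v0 i x - coordinate v i x = of_int (\<phi> v i - \<phi> v0 i)"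
    using v0 by simp
  then show ?thesis
    unfolding circle_map_def v0_def[symmetric] by (rule exp_2pi_int_shift)
qed

text \<open>The origin chosen in \<open>circle_map\<close> may jump, but near \<open>x\<close> a
  fixed vertex \<open>v\<close> of the support of \<open>x\<close> stays in the support and can
  serve as origin throughout.\<close>

lemma continuous_on_circle_map: "continuous_on R (circle_map i)"
  unfolding continuous_on_def
proof
  fix x assume x: "x \<in> R"
  then obtain v where v: "v \<in> supp x"
    using supp_nonempty by blast
  have proj: "((\<lambda>y. y w) \<longlongrightarrow> x w) (at x within R)" for w
    using continuous_on_product_coordinates[of w, where 'b = real] unfolding continuous_on_def
    by (blast intro: tendsto_within_subset)
  have eq: "circle_map i y = exp (2 * of_real pi * \<i> * of_real (coordinate v i y))" if "y \<in> R" "v \<in> supp y" for y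
    using circle_map_eq[of y v i] that by (simp add: insert_absorb realization_iff)
  have "x v > 0"
    using x v unfolding realization_iff supp_def by (simp add: less_le)
  then have "\<forall>\<^sub>F y in at x within R. 0 < y v"
    using order_tendstoD(1)[OF proj] by blast
  moreover have "\<forall>\<^sub>F y in at x within R. y \<in> R"
    by (simp add: eventually_at_filter)
  ultimately have ev: "\<forall>\<^sub>F y in at x within R. exp (2 * of_real pi * \<i> * of_real (coordinate v i y)) = circle_map i y"
    by eventually_elim (auto simp: supp_def intro!: eq[symmetric])
  have "((\<lambda>y. exp (2 * of_real pi * \<i> * of_real (coordinate v i y))) \<longlongrightarrow> exp (2 * of_real pi * \<i> * of_real (coordinate v i x))) (at x within R)"
    unfolding coordinate_def by (intro tendsto_intros proj)
  then show "(circle_map i \<longlongrightarrow> circle_map i x) (at x within R)"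
    unfolding eq[OF x v] by (rule Lim_transform_eventually[OF _ ev])
qed

lemma circle_map_nonzero: "circle_map i x \<noteq> 0"
  by (simp add: circle_map_def)

section \<open>Winding numbers of polygons\<close>

lemma path_circle_map: "path g \<Longrightarrow> path_image g \<subseteq> R \<Longrightarrow> path (circle_map i \<circ> g)"
  by (intro path_continuous_image continuous_on_subset[OF continuous_on_circle_map])

lemma zero_notin_circle_map: "0 \<notin> path_image (circle_map i \<circ> g)"
  using circle_map_nonzero by (auto simp: path_image_def)

lemma winding_homotopic: "homotopic_paths R p q \<Longrightarrow> winding i p = winding i q"
  unfolding winding_def
  by (intro winding_number_homotopic_paths homotopic_paths_continuous_image[where S = R])
     (auto simp: circle_map_nonzero intro: continuous_on_circle_map)

lemma winding_join:
  assumes "path p" "path_image p \<subseteq> R" "path q" "path_image q \<subseteq> R" "pathfinish p = pathstart q"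
  shows "winding i (p +++ q) = winding i p + winding i q"
  unfolding winding_def path_compose_join
  using assms path_circle_map zero_notin_circle_map
  by (intro winding_number_join) (auto simp: pathfinish_compose pathstart_compose)

text \<open>With one origin for the whole simplex the coordinate is affine along the segment, so the
  circle map lifts through \<open>exp\<close> to a straight line.\<close>

lemma winding_seg:
  assumes "x \<in> R" "y \<in> R" "insert v (supp x \<union> supp y) \<in> X"
  shows "winding i (seg x y) = of_real (coordinate v i y - coordinate v i x)"
proof -
  have xy: "compatible x y"
    unfolding compatible_def using supp_nonempty[OF assms(1)] by (intro face_subset[OF assms(3)]) auto
  define l where "l = linepath (2 * of_real pi * \<i> * of_real (coordinate v i x)) (2 * of_real pi * \<i> * of_real (coordinate v i y))"
  have "(circle_map i \<circ> seg x y) t = (exp \<circ> l) t" if t: "t \<in> {0..1}" for t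
  proof -
    have r: "seg x y t \<in> R"
      using seg_in_realization[OF assms(1,2) xy] t by auto
    have "insert v (supp (seg x y t)) \<in> X"
      using supp_seg_subset[of x y t] by (intro face_subset[OF assms(3)]) auto
    then have "circle_map i (seg x y t) = exp (2 * of_real pi * \<i> * of_real (coordinate v i (seg x y t)))"
      by (rule circle_map_eq[OF r])
    also have "coordinate v i (seg x y t) = (1 - t) * coordinate v i x + t * coordinate v i y"
      by (simp add: coordinate_def seg_def sum_distrib_left sum.distrib distrib_right mult.assoc)
    also have "2 * of_real pi * \<i> * of_real \<dots> = l t"
      by (simp add: l_def linepath_def scaleR_conv_of_real algebra_simps)
    finally show ?thesis
      by simp
  qed
  then have "winding i (seg x y) = winding_number (exp \<circ> l) 0"
    unfolding winding_def by (intro winding_number_cong) auto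
  also have "\<dots> = of_real (coordinate v i y - coordinate v i x)"
    by (subst winding_number_compose_exp) (auto simp: l_def field_simps)
  finally show ?thesis .
qed

lemma coordinate_vertex:
  assumes "w \<in> P"
  shows "coordinate v i (vertex w) = of_int (displacement v w i)"
proof -
  have "coordinate v i (vertex w) = (\<Sum>u\<in>P. if u = w then of_int (displacement v w i) else 0)"
    unfolding coordinate_def by (intro sum.cong) (auto simp: vertex_def)
  then show ?thesis
    using assms finite_P by simp
qed

lemma displacement_same: "p \<in> P \<Longrightarrow> displacement p p i = 0"
  using displacement_s[of p 1 1 i] s_same[of p 1] by simp

text \<open>Measured from its own start, an edge runs from coordinate 0 to the coordinate of its
  letter, so the letters add up.\<close>

lemma winding_trail:
  assumes "p \<in> P" "set w \<subseteq> K \<times> K" "polygon (vertex (walk s p w) # y # ys)"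
  shows "winding i (polygonal (map vertex (trail s p w) @ y # ys)) =
    of_int (word_sum w i) + winding i (polygonal (vertex (walk s p w) # y # ys))"
  using assms
proof (induction w arbitrary: p)
  case Nil
  then show ?case by simp
next
  case (Cons x w)
  obtain a b where x: "x = (a, b)"
    by (cases x)
  have K: "a \<in> K" "b \<in> K" and q: "s a b p \<in> P"
    using Cons.prems by (auto simp: x s_closed)
  obtain us where us: "trail s (s a b p) w = s a b p # us"
    using trail_eq_Cons by blast
  have pol: "polygon (map vertex (trail s (s a b p) w) @ y # ys)"
    using polygon_trail[of "s a b p" w "[]" "y # ys"] Cons.prems q vertex_R[OF q] by (simp add: x)
  have e: "{p, s a b p} \<in> X"
    by (rule edge[OF Cons.prems(1) K])
  have "winding i (polygonal (map vertex (trail s p (x # w)) @ y # ys)) =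
    winding i (seg (vertex p) (vertex (s a b p))) + winding i (polygonal (map vertex (trail s (s a b p) w) @ y # ys))"
    using polygonal_path[OF pol] path_image_seg[OF vertex_R[OF Cons.prems(1)] vertex_R[OF q]] e
    by (simp add: x us winding_join path_seg compatible_vertex)
  also have "winding i (seg (vertex p) (vertex (s a b p))) = of_int (word_sum [(a, b)] i)"
    using winding_seg[OF vertex_R[OF Cons.prems(1)] vertex_R[OF q], of p i] e
    by (simp add: coordinate_vertex Cons.prems(1) q displacement_same displacement_s[OF Cons.prems(1) K] insert_commute)
  finally show ?case
    using Cons.IH[OF q] Cons.prems by (simp add: x)
qed

text \<open>By finiteness two powers agree at \<open>p\<close>; as \<open>s b a\<close> undoes
  \<open>s a b\<close>, their common part cancels.\<close>

lemma return_power: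
  assumes "p \<in> P" "a \<in> K" "b \<in> K"
  obtains n where "n > 0" "walk s p (replicate n (a, b)) = p"
proof -
  let ?f = "\<lambda>n. walk s p (replicate n (a, b))"
  have inP: "?f n \<in> P" for n
    using assms by (intro walk_closed) auto
  have Suc: "?f (Suc n) = s a b (?f n)" for n
    by (simp add: walk_append flip: replicate_append_same)
  have "\<not> inj ?f"
    using finite_P inP by (metis finite_subset finite_imageD image_subsetI infinite_UNIV_nat)
  then obtain m n where mn: "m < n" "?f m = ?f n"
    unfolding inj_def by (metis linorder_neqE_nat)
  have "?f m = ?f (m + d) \<Longrightarrow> ?f d = p" for d
  proof (induction m)
    case (Suc m)
    have "s a b (?f m) = s a b (?f (m + d))"
      using Suc.prems Suc by (metis \<open>\<And>n. ?f (Suc n) = s a b (?f n)\<close> add_Suc)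
    then have "s b a (s a b (?f m)) = s b a (s a b (?f (m + d)))"
      by simp
    then have "?f m = ?f (m + d)"
      using s_fuse1[OF inP assms(2,3,2)] s_same[OF inP assms(2)] by simp
    then show ?case
      by (rule Suc.IH)
  qed simp
  from this[of "n - m"] have "?f (n - m) = p"
    using mn by simp
  then show thesis
    using that[of "n - m"] mn(1) by simp
qed

theorem fundamental_group_realization:
  assumes x: "x \<in> R"
  shows "fundamental_group R x \<cong> int_power_group k"
proof -
  obtain v where v: "v \<in> supp x"
    using supp_nonempty[OF x] by blast
  have \<sigma>: "supp x \<in> X" and vx: "insert v (supp x) = supp x"
    using x v by (auto simp: realization_iff)
  have vP: "v \<in> P"
    using face_subset_P[OF \<sigma>] v by auto
  define closed_word where "closed_word w \<longleftrightarrow> set w \<subseteq> K \<times> K \<and> walk s v w = v" for w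
  \<comment> \<open>The base point \<open>x\<close> need not be a vertex: a closed word at
    \<open>v\<close> is joined to it by the segment from \<open>x\<close> to \<open>v\<close> and
    back.\<close>
  define L where "L w = polygonal (x # map vertex (trail s v w) @ [x])" for w
  have xv: "polygon [x, vertex v]" "polygon [vertex v, x]"
    using x v vertex_R[OF vP] \<sigma> by (auto simp: compatible_def vx)
  have polygon_L: "polygon (x # map vertex (trail s v w) @ [x])" if "closed_word w" for w
    using polygon_trail[of v w "[x]" "[x]"] that xv vP by (simp add: closed_word_def)
  have loop_L: "loop_in R x (L w)" if "closed_word w" for w
    using polygonal_path[OF polygon_L[OF that]] pathfinish_polygonal[of "x # map vertex (trail s v w) @ [x]"]
    by (simp add: loop_in_def L_def)
  \<comment> \<open>The segment from \<open>x\<close> to \<open>v\<close> and the one back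
    contribute opposite amounts.\<close>
  have winding_L: "winding i (L w) = of_int (word_sum w i)" if w: "closed_word w" for w i
  proof -
    obtain us where us: "trail s v w = v # us"
      using trail_eq_Cons by blast
    have pol: "polygon (vertex v # map vertex us @ [x])"
      using polygon_L[OF w] by (simp add: us)
    have "winding i (seg x (vertex v) +++ polygonal (vertex v # map vertex us @ [x])) =
      winding i (seg x (vertex v)) + winding i (polygonal (vertex v # map vertex us @ [x]))"
      using polygonal_path[OF pol] path_image_seg[OF x vertex_R[OF vP]] xv
      by (intro winding_join) (auto simp: path_seg)
    then have "winding i (L w) = winding i (seg x (vertex v)) + winding i (polygonal (map vertex (trail s v w) @ [x]))"
      by (simp add: L_def us)
    also have "winding i (polygonal (map vertex (trail s v w) @ [x])) = of_int (word_sum w i) + winding i (polygonal [vertex v, x])"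
      using winding_trail[of v w x "[]" i] w xv vP by (simp add: closed_word_def)
    also have "winding i (polygonal [vertex v, x]) = winding i (seg (vertex v) x)"
      using xv path_image_seg[OF vertex_R[OF vP] x] unfolding polygonal.simps
      by (intro winding_homotopic homotopic_paths_rid_const) (simp_all add: path_seg)
    finally show ?thesis
      using winding_seg[OF x vertex_R[OF vP], of v i] winding_seg[OF vertex_R[OF vP] x, of v i] \<sigma> by (simp add: vx)
  qed
  have loop_word: "\<exists>w. closed_word w \<and> homotopic_paths R p (L w)" if p: "loop_in R x p" for p
  proof -
    obtain xs where xs: "polygon xs" "hd xs = x" "last xs = x" "homotopic_paths R p (polygonal xs)"
      using path_homotopic_polygonal[of p] p unfolding loop_in_def by metis
    obtain w where w: "set w \<subseteq> K \<times> K" "walk s v w \<in> supp x"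
      and pol: "polygon (x # map vertex (trail s v w) @ [x])"
      and hom: "homotopic_paths R (polygonal xs) (L w)"
      using polygonal_homotopic_trail[OF xs(1), of v] xs v unfolding L_def by auto
    \<comment> \<open>The walk may end at another vertex of the support of \<open>x\<close>; one
      letter within that simplex closes it.\<close>
    obtain a b where ab: "a \<in> K" "b \<in> K" "v = s a b (walk s v w)"
      using adjacent[OF w(2) v \<sigma>] by blast
    have cl: "closed_word (w @ [(a, b)])"
      using w ab by (simp add: closed_word_def walk_append)
    obtain us where us: "trail s v w = us @ [walk s v w]"
      using last_trail[of s v w] trail_nonempty by (metis append_butlast_last_id)
    have l: "x # map vertex (trail s v (w @ [(a, b)])) @ [x] = (x # map vertex us) @ [vertex (walk s v w), vertex v, x] @ []"
      using ab(3) by (simp add: trail_snoc us)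
    have "supp (vertex (walk s v w)) \<union> supp (vertex v) \<union> supp x \<in> X"
      using w(2) v \<sigma> by (simp add: insert_absorb)
    from polygonal_remove_middle(2)[OF polygon_L[OF cl, unfolded l] this]
    have "homotopic_paths R (L (w @ [(a, b)])) (L w)"
      unfolding L_def l by (simp add: us)
    then have "homotopic_paths R p (L (w @ [(a, b)]))"
      using xs(4) hom by (blast intro: homotopic_paths_trans homotopic_paths_sym)
    then show ?thesis
      using cl by blast
  qed
  \<comment> \<open>The winding numbers of loops turn out to be integers, so the floor only changes
    the type. The indices below \<open>k\<close> stand for the colors 1 to \<open>k\<close>; color
    \<open>k + 1\<close> is omitted.\<close>
  define W where "W p i = \<lfloor>Re (winding (Suc i) p)\<rfloor>" for p i
  have W_word: "W p i = word_sum w (Suc i)" if "closed_word w" "homotopic_paths R p (L w)" for p w i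
    using winding_homotopic[OF that(2)] winding_L[OF that(1)] by (simp add: W_def)
  have winding_W: "winding (Suc i) p = of_int (W p i)" if p: "loop_in R x p" for p i
    using loop_word[OF p] W_word winding_homotopic winding_L by metis
  show ?thesis
  proof (rule fundamental_group_iso_int_power[where W = W, OF _ _ _ x])
    fix p q assume p: "loop_in R x p" and q: "loop_in R x q"
    obtain w w' where w: "closed_word w" "homotopic_paths R p (L w)" and w': "closed_word w'" "homotopic_paths R q (L w')"
      using loop_word p q by blast
    show "homotopic_paths R p q \<longleftrightarrow> (\<forall>i<k. W p i = W q i)"
    proof
      assume "homotopic_paths R p q"
      then show "\<forall>i<k. W p i = W q i"
        using winding_homotopic by (simp add: W_def)
    next
      assume eq: "\<forall>i<k. W p i = W q i"
      have K: "set w \<subseteq> K \<times> K" "set w' \<subseteq> K \<times> K"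
        using w(1) w'(1) by (auto simp: closed_word_def)
      have eq1: "word_sum w i = word_sum w' i" if "i \<in> {1..k}" for i
        using that eq W_word[OF w, of "i - 1"] W_word[OF w', of "i - 1"] by auto
      \<comment> \<open>Both words have total 0, so the omitted coordinate agrees as well.\<close>
      then have "(\<Sum>i=1..k. word_sum w i) = (\<Sum>i=1..k. word_sum w' i)"
        by (rule sum.cong[OF HOL.refl])
      then have eq2: "word_sum w (k + 1) = word_sum w' (k + 1)"
        using word_sum_total[OF _ K(1)] word_sum_total[OF _ K(2)] by simp
      have "word_sum w i = word_sum w' i" for i
      proof (cases "i \<in> K")
        case True
        then show ?thesis
          using eq1 eq2 by (cases "i = k + 1") auto
      next
        case False
        then show ?thesis
          using word_sum_outside[OF K(1)] word_sum_outside[OF K(2)] by simp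
      qed
      then have "word_eq K w w'"
        by (rule word_eq_if_same_sum[OF K])
      then have "homotopic_paths R (L w) (L w')"
        using word_eq_homotopic[of w w' v "[x]" x "[]"] vP xv w(1) by (simp add: L_def closed_word_def)
      then show "homotopic_paths R p q"
        using w(2) w'(2) by (blast intro: homotopic_paths_trans homotopic_paths_sym)
    qed
    show "W (p +++ q) i = W p i + W q i" for i
    proof -
      have "winding (Suc i) (p +++ q) = of_int (W p i + W q i)"
        using winding_join[of p q "Suc i"] winding_W[OF p, of i] winding_W[OF q, of i] p q
        by (simp add: loop_in_def)
      then show ?thesis
        unfolding W_def[of "p +++ q"] by simp
    qed
  next
    fix i assume i: "i < k"
    then have K: "Suc i \<in> K" "k + 1 \<in> K"
      by auto
    \<comment> \<open>The index \<open>k + 1\<close> subtracts in the omitted coordinate, so the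
      word contributes just \<open>n\<close> times a unit vector.\<close>
    obtain n where n: "n > 0" "walk s v (replicate n (Suc i, k + 1)) = v"
      using return_power[OF vP K] by blast
    let ?w = "replicate n (Suc i, k + 1)"
    have cl: "closed_word ?w"
      using n K by (auto simp: closed_word_def)
    have "word_sum ?w j = int n * (of_bool (Suc i = j) - of_bool (k + 1 = j))" for j
      by (induction n) (auto simp: algebra_simps)
    then have "W (L ?w) j = (if j = i then int n else 0)" if "j < k" for j
      using W_word[OF cl, of "L ?w" j] loop_L[OF cl] that i by (simp add: loop_in_def)
    then show "\<exists>p N. loop_in R x p \<and> N > 0 \<and> (\<forall>j<k. W p j = (if j = i then N else 0))"
      using loop_L[OF cl] n(1) by (intro exI[of _ "L ?w"] exI[of _ "int n"]) simp
  qed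
qed

theorem connected_realization: "connected R"
proof -
  have "path_connected R"
    unfolding path_connected_def
  proof (intro ballI)
    fix x y assume x: "x \<in> R" and y: "y \<in> R"
    obtain u v where u: "u \<in> supp x" and v: "v \<in> supp y"
      using supp_nonempty x y by blast
    have \<sigma>: "supp x \<in> X" "supp y \<in> X"
      using x y by (auto simp: realization_iff)
    have P: "u \<in> P" "v \<in> P"
      using u v face_subset_P \<sigma> by blast+
    obtain w where w: "set w \<subseteq> K \<times> K" "walk s u w = v"
      using s_transitive[OF P] by blast
    have "polygon [x, vertex u]" "polygon [vertex v, y]"
      using x y u v vertex_R[OF P(1)] vertex_R[OF P(2)] \<sigma> by (auto simp: compatible_def insert_absorb)
    then have pol: "polygon (x # map vertex (trail s u w) @ [y])"
      using polygon_trail[OF P(1) w(1), of "[x]" "[y]"] w(2) by simp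
    show "\<exists>g. path g \<and> path_image g \<subseteq> R \<and> pathstart g = x \<and> pathfinish g = y"
      using polygonal_path[OF pol] pathfinish_polygonal[of "x # map vertex (trail s u w) @ [y]"]
      by (intro exI[of _ "polygonal (x # map vertex (trail s u w) @ [y])"]) simp
  qed
  then show ?thesis
    by (rule path_connected_imp_connected)
qed

end

section \<open>The complex of a colored configuration\<close>

locale colored_config =
  fixes C :: "('p, 'l) config" and k :: nat
  assumes k_ge_2: "k \<ge> 2" and colored: "colored_configuration (k + 1) C"
begin

abbreviation K :: "nat set" where "K \<equiv> {1..k + 1}"

section \<open>Lines and points selected by color\<close>

definition color :: "'p \<Rightarrow> 'l \<Rightarrow> nat" where
  "color p l = col C {Inl p, Inr l}"

definition line :: "nat \<Rightarrow> 'p \<Rightarrow> 'l" where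
  "line c p = (THE l. (p, l) \<in> inc C \<and> color p l = c)"

definition point :: "nat \<Rightarrow> 'l \<Rightarrow> 'p" where
  "point c l = (THE p. (p, l) \<in> inc C \<and> color p l = c)"

lemma finite_points: "finite (points C)"
  and inc_subset: "inc C \<subseteq> points C \<times> lines C"
  and card_lines_through: "\<And>p. p \<in> points C \<Longrightarrow> card {l \<in> lines C. (p, l) \<in> inc C} = k + 1"
  and card_points_on: "\<And>l. l \<in> lines C \<Longrightarrow> card {p \<in> points C. (p, l) \<in> inc C} = k + 1"
  using colored unfolding colored_configuration_def configuration_def by auto

lemma inc_points: "(p, l) \<in> inc C \<Longrightarrow> p \<in> points C"
  and inc_lines: "(p, l) \<in> inc C \<Longrightarrow> l \<in> lines C"
  using inc_subset by auto

lemma two_points_one_line: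
  assumes "(p, l) \<in> inc C" "(p, m) \<in> inc C" "(q, l) \<in> inc C" "(q, m) \<in> inc C" "p \<noteq> q"
  shows "l = m"
  using colored assms inc_points inc_lines unfolding colored_configuration_def configuration_def by meson

lemma edge_iff: "{Inl p, Inr l} \<in> inc_edges C \<longleftrightarrow> (p, l) \<in> inc C"
  by (auto simp: inc_edges_def doubleton_eq_iff)

lemma color_in_K: "(p, l) \<in> inc C \<Longrightarrow> color p l \<in> K"
  using colored edge_iff[of p l] unfolding colored_configuration_def edge_coloring_def color_def by blast

lemma coloring_proper:
  "e \<in> inc_edges C \<Longrightarrow> f \<in> inc_edges C \<Longrightarrow> e \<inter> f \<noteq> {} \<Longrightarrow> col C e = col C f \<Longrightarrow> e = f"
  using colored unfolding colored_configuration_def edge_coloring_def by blast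

lemma color_inj_line:
  assumes "(p, l) \<in> inc C" "(p, m) \<in> inc C" "color p l = color p m"
  shows "l = m"
proof -
  have "{Inl p, Inr l} = ({Inl p, Inr m} :: ('p + 'l) set)"
    using assms by (intro coloring_proper) (auto simp: edge_iff color_def)
  then show ?thesis
    by (auto simp: doubleton_eq_iff)
qed

lemma color_inj_point:
  assumes "(p, l) \<in> inc C" "(q, l) \<in> inc C" "color p l = color q l"
  shows "p = q"
proof -
  have "{Inl p, Inr l} = ({Inl q, Inr l} :: ('p + 'l) set)"
    using assms by (intro coloring_proper) (auto simp: edge_iff color_def)
  then show ?thesis
    by (auto simp: doubleton_eq_iff)
qed

text \<open>A proper coloring is injective on the \<open>k + 1\<close> lines through
  \<open>p\<close> and takes values among \<open>k + 1\<close> colors, so every color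
  occurs.\<close>

lemma line:
  assumes "p \<in> points C" "c \<in> K"
  shows "(p, line c p) \<in> inc C" "color p (line c p) = c"
proof -
  let ?S = "{l \<in> lines C. (p, l) \<in> inc C}"
  have "inj_on (color p) ?S"
    by (auto intro!: inj_onI color_inj_line)
  then have "card (color p ` ?S) = card K"
    using card_lines_through[OF assms(1)] by (simp add: card_image)
  moreover have "color p ` ?S \<subseteq> K"
    using color_in_K by auto
  ultimately have "color p ` ?S = K"
    by (intro card_subset_eq) auto
  then have "c \<in> color p ` ?S"
    using assms(2) by simp
  then obtain l where "(p, l) \<in> inc C" "color p l = c"
    by blast
  then have "(p, line c p) \<in> inc C \<and> color p (line c p) = c"
    unfolding line_def by (intro theI[of "\<lambda>l. (p, l) \<in> inc C \<and> color p l = c" l]) (auto intro: color_inj_line)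
  then show "(p, line c p) \<in> inc C" "color p (line c p) = c"
    by auto
qed

lemma point:
  assumes "l \<in> lines C" "c \<in> K"
  shows "(point c l, l) \<in> inc C" "color (point c l) l = c"
proof -
  let ?S = "{p \<in> points C. (p, l) \<in> inc C}"
  have "inj_on (\<lambda>p. color p l) ?S"
    by (auto intro!: inj_onI color_inj_point)
  then have "card ((\<lambda>p. color p l) ` ?S) = card K"
    using card_points_on[OF assms(1)] by (simp add: card_image)
  moreover have "(\<lambda>p. color p l) ` ?S \<subseteq> K"
    using color_in_K by auto
  ultimately have "(\<lambda>p. color p l) ` ?S = K"
    by (intro card_subset_eq) auto
  then have "c \<in> (\<lambda>p. color p l) ` ?S"
    using assms(2) by simp
  then obtain p where "(p, l) \<in> inc C" "color p l = c"
    by blast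
  then have "(point c l, l) \<in> inc C \<and> color (point c l) l = c"
    unfolding point_def by (intro theI[of "\<lambda>p. (p, l) \<in> inc C \<and> color p l = c" p]) (auto intro: color_inj_point)
  then show "(point c l, l) \<in> inc C" "color (point c l) l = c"
    by auto
qed

lemma line_in_lines: "p \<in> points C \<Longrightarrow> c \<in> K \<Longrightarrow> line c p \<in> lines C"
  using line(1) inc_lines by blast

lemma point_in_points: "l \<in> lines C \<Longrightarrow> c \<in> K \<Longrightarrow> point c l \<in> points C"
  using point(1) inc_points by blast

lemma line_eqI: "(p, l) \<in> inc C \<Longrightarrow> color p l = c \<Longrightarrow> line c p = l"
  using line[of p c] color_in_K[of p l] inc_points by (auto intro: color_inj_line)

lemma point_eqI: "(p, l) \<in> inc C \<Longrightarrow> color p l = c \<Longrightarrow> point c l = p"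
  using point[of l c] color_in_K[of p l] inc_lines by (auto intro: color_inj_point)

lemma point_line: "p \<in> points C \<Longrightarrow> c \<in> K \<Longrightarrow> point c (line c p) = p"
  using line by (intro point_eqI) auto

lemma line_point: "l \<in> lines C \<Longrightarrow> c \<in> K \<Longrightarrow> line c (point c l) = l"
  using point by (intro line_eqI) auto

lemma color_neighbor_Inl:
  assumes "p \<in> points C" "c \<in> K"
  shows "color_neighbor (inc_edges C) (col C) c (Inl p) = Inr (line c p)"
  unfolding color_neighbor_def
proof (rule the_equality)
  show "{Inl p, Inr (line c p)} \<in> inc_edges C \<and> col C {Inl p, Inr (line c p)} = c"
    using line[OF assms] by (simp add: edge_iff color_def)
  fix w assume w: "{Inl p, w} \<in> inc_edges C \<and> col C {Inl p, w} = c"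
  then obtain l where "w = Inr l"
    by (auto simp: inc_edges_def doubleton_eq_iff)
  then show "w = Inr (line c p)"
    using w line_eqI[of p l c] by (simp add: edge_iff color_def)
qed

lemma color_neighbor_Inr:
  assumes "l \<in> lines C" "c \<in> K"
  shows "color_neighbor (inc_edges C) (col C) c (Inr l) = Inl (point c l)"
  unfolding color_neighbor_def
proof (rule the_equality)
  show "{Inr l, Inl (point c l)} \<in> inc_edges C \<and> col C {Inr l, Inl (point c l)} = c"
    using point[OF assms] edge_iff[of "point c l" l] by (simp add: color_def insert_commute)
  fix w assume w: "{Inr l, w} \<in> inc_edges C \<and> col C {Inr l, w} = c"
  then obtain p where "w = Inl p"
    by (auto simp: inc_edges_def doubleton_eq_iff)
  then show "w = Inl (point c l)"
    using w point_eqI[of p l c] edge_iff[of p l] by (simp add: color_def insert_commute)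
qed

lemma six_cycle:
  assumes "p \<in> points C" "a \<in> K" "b \<in> K" "c \<in> K" "a \<noteq> b" "a \<noteq> c" "b \<noteq> c"
  shows "point c (line b (point a (line c (point b (line a p))))) = p"
proof -
  let ?\<phi> = "color_neighbor (inc_edges C) (col C)"
  have "Inl p \<in> inc_verts C"
    using assms(1) by (auto simp: inc_verts_def)
  moreover have "six_cycle_property (k + 1) (inc_verts C) (inc_edges C) (col C)"
    using colored unfolding colored_configuration_def by blast
  ultimately have "(?\<phi> c \<circ> ?\<phi> b \<circ> ?\<phi> a \<circ> ?\<phi> c \<circ> ?\<phi> b \<circ> ?\<phi> a) (Inl p) = Inl p"
    using assms(2-7) unfolding six_cycle_property_def Let_def by blast
  then show ?thesis
    using assms(1-4) by (simp add: color_neighbor_Inl color_neighbor_Inr line_in_lines point_in_points del: atLeastAtMost_iff)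
qed

section \<open>The translations of the point set\<close>

definition shift :: "nat \<Rightarrow> nat \<Rightarrow> 'p \<Rightarrow> 'p" where
  "shift a b p = point b (line a p)"

lemma shift_points: "p \<in> points C \<Longrightarrow> a \<in> K \<Longrightarrow> b \<in> K \<Longrightarrow> shift a b p \<in> points C"
  unfolding shift_def by (intro point_in_points line_in_lines)

text \<open>The 6-cycle with colors \<open>b\<close>, \<open>c\<close>, \<open>a\<close> says that
  \<open>shift c a\<close> takes the left side \<open>r\<close> back to \<open>p\<close>; inverting
  this gives the claim. When two indices coincide, a color is followed back and forth and
  cancels.\<close>

lemma shift_fuse2:
  assumes "p \<in> points C" "a \<in> K" "b \<in> K" "c \<in> K"
  shows "shift a b (shift b c p) = shift a c p"
proof -
  have q: "point c (line b p) \<in> points C"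
    using assms by (intro point_in_points line_in_lines)
  consider "a = b" | "b = c" | "a = c" | "a \<noteq> b" "a \<noteq> c" "b \<noteq> c"
    by blast
  then show ?thesis
  proof cases
    case 1
    then show ?thesis
      using point_line[OF q assms(2)] by (simp add: shift_def)
  next
    case 2
    then show ?thesis
      using point_line[OF assms(1,3)] by (simp add: shift_def)
  next
    case 3
    then show ?thesis
      using point_line[OF assms(1,2)] point_line[OF assms(1,3)] line_point[OF line_in_lines[OF assms(1,3)] assms(4)]
      by (simp add: shift_def)
  next
    case 4
    define r where "r = point b (line a (point c (line b p)))"
    have r: "r \<in> points C"
      unfolding r_def using assms q by (intro point_in_points line_in_lines)
    have "point a (line c r) = p"
      unfolding r_def using six_cycle[of p b c a] assms 4 by auto
    then have "line c r = line a p"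
      using line_point[OF line_in_lines[OF r assms(4)] assms(2)] by simp
    then have "r = point c (line a p)"
      using point_line[OF r assms(4)] by simp
    then show ?thesis
      by (simp add: shift_def r_def)
  qed
qed

text \<open>If the common image \<open>q\<close> differs from \<open>p\<close>, the lines used by
  both moves contain \<open>p\<close> and \<open>q\<close> and hence agree, and so do the colors at
  \<open>p\<close> and at \<open>q\<close>. If \<open>q = p\<close>, each move leaves and returns
  along the same incidence.\<close>

lemma shift_inj:
  assumes p: "p \<in> points C" and K: "a \<in> K" "b \<in> K" "c \<in> K" "d \<in> K" and eq: "shift a b p = shift c d p"
  shows "a = b \<and> c = d \<or> a = c \<and> b = d"
proof -
  define q where "q = shift a b p"
  have a: "(p, line a p) \<in> inc C" "color p (line a p) = a" "(q, line a p) \<in> inc C" "color q (line a p) = b"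
    using line[OF p K(1)] point[OF line_in_lines[OF p K(1)] K(2)] by (auto simp: q_def shift_def)
  have c: "(p, line c p) \<in> inc C" "color p (line c p) = c" "(q, line c p) \<in> inc C" "color q (line c p) = d"
    using line[OF p K(3)] point[OF line_in_lines[OF p K(3)] K(4)] by (auto simp: q_def eq) (auto simp: shift_def)
  show ?thesis
  proof (cases "p = q")
    case True
    then show ?thesis
      using a(2,4) c(2,4) by metis
  next
    case False
    then have "line a p = line c p"
      using two_points_one_line a c by blast
    then show ?thesis
      using a(2,4) c(2,4) by metis
  qed
qed

lemma points_nonempty: "points C \<noteq> {}"
proof -
  have "inc_verts C \<noteq> {}"
    using colored unfolding colored_configuration_def graph_connected_def by blast
  then consider p where "p \<in> points C" | l where "l \<in> lines C"
    unfolding inc_verts_def by blast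
  then show ?thesis
    using point_in_points[of _ 1] by cases auto
qed

text \<open>Induction along a path in the incidence graph. The invariant at a line is that all of
  its points are reachable.\<close>

lemma shift_transitive:
  assumes "p \<in> points C" "q \<in> points C"
  shows "\<exists>w. set w \<subseteq> K \<times> K \<and> walk shift p w = q"
proof -
  define reach where "reach q \<longleftrightarrow> (\<exists>w. set w \<subseteq> K \<times> K \<and> walk shift p w = q)" for q
  have step: "reach (shift a b q)" if "reach q" "a \<in> K" "b \<in> K" for q a b
  proof -
    obtain w where "set w \<subseteq> K \<times> K" "walk shift p w = q"
      using \<open>reach q\<close> unfolding reach_def by blast
    then show ?thesis
      using that unfolding reach_def by (intro exI[of _ "w @ [(a, b)]"]) (simp add: walk_append)
  qed
  have "(Inl p, Inl q) \<in> {(x, y). {x, y} \<in> inc_edges C}\<^sup>*"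
    using colored assms unfolding colored_configuration_def graph_connected_def inc_verts_def by blast
  then have "case Inl q of Inl q' \<Rightarrow> reach q' | Inr l \<Rightarrow> \<forall>c\<in>K. reach (point c l)"
  proof (induction rule: rtrancl_induct)
    case base
    show ?case
      by (auto simp: reach_def intro!: exI[of _ "[]"])
  next
    case (step y z)
    then have "{y, z} \<in> inc_edges C"
      by simp
    then obtain r l where rl: "(r, l) \<in> inc C" "y = Inl r \<and> z = Inr l \<or> y = Inr l \<and> z = Inl r"
      unfolding inc_edges_def by (auto simp: doubleton_eq_iff)
    have c: "color r l \<in> K" "line (color r l) r = l" "point (color r l) l = r"
      using rl(1) color_in_K line_eqI point_eqI by auto
    from rl(2) show ?case
    proof
      assume yz: "y = Inl r \<and> z = Inr l"
      then have "reach r"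
        using step.IH by simp
      then have "reach (point b l)" if "b \<in> K" for b
        using \<open>\<And>q a b. reach q \<Longrightarrow> a \<in> K \<Longrightarrow> b \<in> K \<Longrightarrow> reach (shift a b q)\<close>[of r "color r l" b] c that
        by (simp add: shift_def)
      then show ?case
        using yz by simp
    next
      assume yz: "y = Inr l \<and> z = Inl r"
      then have "reach (point (color r l) l)"
        using step.IH c(1) by simp
      then show ?case
        using yz c(3) by simp
    qed
  qed
  then show ?thesis
    by (simp add: reach_def)
qed

sublocale translation?: translation_structure k "points C" shift
proof unfold_locales
  \<comment> \<open>Both moves run along \<open>line a p\<close>: arriving by color \<open>b\<close>
    and leaving by color \<open>b\<close> cancel.\<close>
  show "shift b c (shift a b p) = shift a c p"
    if "p \<in> points C" "a \<in> K" "b \<in> K" "c \<in> K" for p a b c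
    using that line_point[OF line_in_lines] by (simp add: shift_def)
  show "shift a a p = p" if "p \<in> points C" "a \<in> K" for p a
    using that point_line by (simp add: shift_def)
qed (use finite_points shift_points shift_fuse2 shift_inj shift_transitive in auto)

section \<open>Facets and dimension\<close>

definition points_on :: "'l \<Rightarrow> 'p set" where
  "points_on l = {p. (p, l) \<in> inc C}"

lemma points_on_eq: "l \<in> lines C \<Longrightarrow> points_on l = (\<lambda>c. point c l) ` K"
proof (intro equalityI subsetI)
  fix p assume "p \<in> points_on l"
  then have "p = point (color p l) l" "color p l \<in> K"
    using point_eqI[of p l] color_in_K by (auto simp: points_on_def)
  then show "p \<in> (\<lambda>c. point c l) ` K"
    by blast
qed (use point in \<open>auto simp: points_on_def\<close>)

lemma upper_eq: "p \<in> points C \<Longrightarrow> a \<in> K \<Longrightarrow> upper p a = points_on (line a p)"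
  by (simp add: upper_def shift_def points_on_eq line_in_lines)

text \<open>In lattice terms, \<open>p + e_c - e_a = (p + e_1 - e_a) + e_c - e_1\<close>. With the
  color 1 fixed, the lower facets are indexed by points alone.\<close>

lemma lower_change_color:
  assumes "p \<in> points C" "a \<in> K"
  shows "lower p a = lower (shift 1 a p) 1"
  unfolding lower_def using assms by (intro image_cong) (auto simp: shift_fuse2)

lemma card_points_on_line: "l \<in> lines C \<Longrightarrow> card (points_on l) = k + 1"
  using card_points_on[of l] inc_points by (simp add: points_on_def) (metis (mono_tags, lifting) Collect_cong)

lemma card_lower:
  assumes "p \<in> points C" "a \<in> K"
  shows "card (lower p a) = k + 1"
proof -
  have "inj_on (\<lambda>c. shift c a p) K"
    using shift_inj[OF assms(1) _ assms(2) _ assms(2)] by (intro inj_onI) blast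
  then show ?thesis
    by (simp add: lower_def card_image)
qed

lemma points_on_X: "l \<in> lines C \<Longrightarrow> points_on l \<in> X"
  using point[of l 1] line_eqI[of "point 1 l" l 1] inc_points
  by (intro X_I[of _ "point 1 l" 1]) (auto simp: upper_eq points_on_def)

lemma lower_X: "p \<in> points C \<Longrightarrow> a \<in> K \<Longrightarrow> lower p a \<in> X"
  by (intro X_I[of _ p a]) (auto simp: lower_def)

lemma face_in_facet:
  assumes "\<sigma> \<in> X"
  shows "\<exists>\<tau>\<in>points_on ` lines C \<union> (\<lambda>p. lower p 1) ` points C. \<sigma> \<subseteq> \<tau>"
proof -
  obtain p a where p: "p \<in> points C" "a \<in> K" "\<sigma> \<subseteq> upper p a \<or> \<sigma> \<subseteq> lower p a"
    using assms unfolding X_def by blast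
  have "upper p a \<in> points_on ` lines C"
    using p line_in_lines by (simp add: upper_eq)
  moreover have "lower p a \<in> (\<lambda>p. lower p 1) ` points C"
    using p shift_points[OF p(1), of 1 a] by (simp add: lower_change_color)
  ultimately show ?thesis
    using p(3) by blast
qed

text \<open>Every face lies in a listed one, and all listed faces have the same cardinality, so none
  of them is properly contained in a face.\<close>

lemma facets_X: "facets X = points_on ` lines C \<union> (\<lambda>p. lower p 1) ` points C" (is "_ = ?F")
proof -
  have F: "\<tau> \<in> X" "card \<tau> = k + 1" "finite \<tau>" if "\<tau> \<in> ?F" for \<tau>
    using that points_on_X lower_X[of _ 1] card_points_on_line card_lower[of _ 1] face_finite by auto
  show ?thesis
  proof (intro equalityI subsetI)
    fix \<sigma> assume \<sigma>: "\<sigma> \<in> facets X"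
    then have "\<sigma> \<in> X" and max: "\<And>\<tau>. \<tau> \<in> X \<Longrightarrow> \<sigma> \<subseteq> \<tau> \<Longrightarrow> \<sigma> = \<tau>"
      by (simp_all add: facets_def)
    obtain \<tau> where \<tau>: "\<tau> \<in> ?F" "\<sigma> \<subseteq> \<tau>"
      using face_in_facet[OF \<open>\<sigma> \<in> X\<close>] by (rule bexE)
    then show "\<sigma> \<in> ?F"
      using max[OF F(1)[OF \<tau>(1)] \<tau>(2)] by simp
  next
    fix \<sigma> assume \<sigma>: "\<sigma> \<in> ?F"
    have "\<sigma> = \<tau>" if \<tau>: "\<tau> \<in> X" "\<sigma> \<subseteq> \<tau>" for \<tau>
    proof -
      obtain \<tau>' where \<tau>': "\<tau>' \<in> ?F" "\<tau> \<subseteq> \<tau>'"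
        using face_in_facet[OF \<tau>(1)] by (rule bexE)
      then have "\<sigma> = \<tau>'"
        using F[OF \<sigma>] F[OF \<tau>'(1)] \<tau>(2) by (intro card_subset_eq) auto
      then show ?thesis
        using \<tau>(2) \<tau>'(2) by blast
    qed
    then show "\<sigma> \<in> facets X"
      using F(1)[OF \<sigma>] by (simp add: facets_def)
  qed
qed

lemma verts_X: "verts X = points C"
  unfolding verts_def using face_subset_P singleton by blast

lemma has_dimension_X: "has_dimension X k"
proof -
  have "card \<sigma> \<le> k + 1" if \<sigma>: "\<sigma> \<in> X" for \<sigma>
  proof -
    obtain \<tau> where \<tau>: "\<tau> \<in> points_on ` lines C \<union> (\<lambda>p. lower p 1) ` points C" "\<sigma> \<subseteq> \<tau>"
      using face_in_facet[OF \<sigma>] by (rule bexE)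
    then have "card \<tau> = k + 1" "finite \<tau>"
      using card_points_on_line card_lower[of _ 1] points_on_X lower_X[of _ 1] face_finite by auto
    then show ?thesis
      using card_mono[OF _ \<tau>(2)] by simp
  qed
  moreover obtain p where "p \<in> points C"
    using points_nonempty by blast
  ultimately show ?thesis
    using lower_X[of p 1] card_lower[of p 1] unfolding has_dimension_def by auto
qed

lemma inj_points_on: "inj_on points_on (lines C)"
proof (rule inj_onI)
  fix l m assume lm: "l \<in> lines C" "m \<in> lines C" "points_on l = points_on m"
  have "point 1 l \<noteq> point 2 l"
    using point(2)[OF lm(1), of 1] point(2)[OF lm(1), of 2] k_ge_2 by auto
  moreover have "point 1 l \<in> points_on l" "point 2 l \<in> points_on l"
    using point(1)[OF lm(1)] k_ge_2 by (auto simp: points_on_def)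
  ultimately show "l = m"
    using lm(3) two_points_one_line[of "point 1 l" l m "point 2 l"] by (simp add: points_on_def set_eq_iff)
qed

text \<open>Equal facets give letters \<open>(c, 1)\<close> from \<open>q\<close> to
  \<open>p\<close> and \<open>(d, 1)\<close> from \<open>p\<close> to \<open>q\<close>. Inverting
  the latter gives \<open>(1, d)\<close> from \<open>q\<close> to \<open>p\<close>, and injectivity
  forces \<open>c = 1\<close>.\<close>

lemma inj_lower: "inj_on (\<lambda>p. lower p 1) (points C)"
proof (rule inj_onI)
  fix p q assume pq: "p \<in> points C" "q \<in> points C" "lower p 1 = lower q 1"
  have K: "1 \<in> K"
    by simp
  have "p \<in> lower p 1" "q \<in> lower q 1"
    using pq(1,2) s_same K by (auto intro!: lowerI[of 1])
  then obtain c d where c: "c \<in> K" "p = shift c 1 q" and d: "d \<in> K" "q = shift d 1 p"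
    using pq(3) unfolding lower_def by blast
  have "shift 1 d q = shift 1 d (shift d 1 p)"
    using d(2) by simp
  also have "\<dots> = shift 1 1 p"
    using d(1) pq(1) K by (intro shift_fuse2)
  also have "\<dots> = shift c 1 q"
    using c(2) s_same[OF pq(1) K] by simp
  finally have "1 = d \<and> c = 1 \<or> 1 = c \<and> d = 1"
    using shift_inj[OF pq(2) K d(1) c(1) K] by blast
  then show "p = q"
    using c(2) s_same[OF pq(2) K] by auto
qed

text \<open>The facet \<open>lower p 1\<close> contains \<open>p\<close> and, for the colors 2 and
  3, further points on two different lines through \<open>p\<close>. The color 3 exists because
  \<open>k \<ge> 2\<close>.\<close>

lemma points_on_neq_lower:
  assumes "l \<in> lines C" "p \<in> points C"
  shows "points_on l \<noteq> lower p 1"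
proof
  assume eq: "points_on l = lower p 1"
  have "shift 1 1 p = p"
    using s_same[OF assms(2), of 1] by simp
  then have p: "(p, l) \<in> inc C"
    using eq lowerI[of 1 p 1 p] by (simp add: points_on_def set_eq_iff)
  have "l = line c p" if c: "c \<in> K" "c \<noteq> 1" for c
  proof -
    have q: "(shift c 1 p, line c p) \<in> inc C" "color (shift c 1 p) (line c p) = 1"
      using point[OF line_in_lines[OF assms(2) c(1)], of 1] by (auto simp: shift_def)
    have "(shift c 1 p, l) \<in> inc C"
      using eq lowerI[of c "shift c 1 p" 1 p] c(1) by (simp add: points_on_def set_eq_iff)
    moreover have "p \<noteq> shift c 1 p"
      using q(2) line(2)[OF assms(2) c(1)] c(2) by auto
    ultimately show ?thesis
      using two_points_one_line[OF p line(1)[OF assms(2) c(1)]] q(1) by blast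
  qed
  from this[of 2] this[of 3] have "line 2 p = line 3 p"
    using k_ge_2 by simp
  then show False
    using line(2)[OF assms(2), of 2] line(2)[OF assms(2), of 3] k_ge_2 by simp
qed

section \<open>The copies of the configuration and of its dual\<close>

lemma config_copy_points:
  "config_copy C X (\<lambda>p. p) points_on (points_on ` lines C)"
  unfolding config_copy_def verts_X facets_X bij_betw_def
  using inj_points_on by (auto simp: points_on_def)

text \<open>A line is represented by its point of color 1, and \<open>lower p 1\<close> collects
  these representatives for the lines through \<open>p\<close>.\<close>

lemma config_copy_dual:
  "config_copy (dual C) X (point 1) (\<lambda>p. lower p 1) ((\<lambda>p. lower p 1) ` points C)"
proof -
  have "inj_on (point 1) (lines C)"
    using line_point[of _ 1] by (intro inj_on_inverseI[of _ "line 1"]) simp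
  moreover have "point 1 ` lines C = points C"
    using point_in_points[of _ 1] point_line[of _ 1] line_in_lines[of _ 1] by (auto simp: image_iff) metis
  moreover have "(p, l) \<in> inc C \<longleftrightarrow> point 1 l \<in> lower p 1" if "p \<in> points C" "l \<in> lines C" for p l
  proof
    assume "(p, l) \<in> inc C"
    then show "point 1 l \<in> lower p 1"
      using color_in_K[of p l] line_eqI[of p l] by (intro lowerI[of "color p l"]) (auto simp: shift_def)
  next
    assume "point 1 l \<in> lower p 1"
    then obtain c where c: "c \<in> K" "point 1 l = point 1 (line c p)"
      unfolding lower_def shift_def by blast
    then have "l = line c p"
      using line_point[OF that(2), of 1] line_point[OF line_in_lines[OF that(1) c(1)], of 1] by simp
    then show "(p, l) \<in> inc C"
      using line(1)[OF that(1) c(1)] by simp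
  qed
  ultimately show ?thesis
    unfolding config_copy_def verts_X facets_X bij_betw_def dual_def using inj_lower by auto
qed

lemma two_neighborly_X:
  assumes "projective_plane C"
  shows "two_neighborly X"
  unfolding two_neighborly_def verts_X
proof (intro ballI impI)
  fix p q assume "p \<in> points C" "q \<in> points C" "p \<noteq> q"
  then have "\<exists>!l. l \<in> lines C \<and> (p, l) \<in> inc C \<and> (q, l) \<in> inc C"
    using assms unfolding projective_plane_def by simp
  then obtain l where l: "l \<in> lines C" "(p, l) \<in> inc C" "(q, l) \<in> inc C"
    by (auto elim: ex1E)
  have "{p, q} \<subseteq> points_on l"
    using l by (simp add: points_on_def)
  then show "{p, q} \<in> X"
    by (rule face_subset[OF points_on_X[OF l(1)]]) simp
qed

subsection \<open>Automorphisms\<close>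

lemma config_homs_iff:
  "(f, g, h) \<in> config_homs (k + 1) C C \<longleftrightarrow>
    f \<in> points C \<rightarrow>\<^sub>E points C \<and> g \<in> lines C \<rightarrow>\<^sub>E lines C \<and> h \<in> K \<rightarrow>\<^sub>E K \<and>
    (\<forall>p l. (p, l) \<in> inc C \<longrightarrow> (f p, g l) \<in> inc C \<and> color (f p) (g l) = h (color p l))"
  unfolding config_homs_def color_def by auto

text \<open>A homomorphism with color map \<open>h\<close> intertwines \<open>shift a b\<close> with
  \<open>shift (h a) (h b)\<close>, so it carries upper simplices into upper ones and lower into
  lower.\<close>

lemma config_hom_face:
  assumes "(f, g, h) \<in> config_homs (k + 1) C C" "\<sigma> \<in> X"
  shows "f ` \<sigma> \<in> X"
proof -
  have hom: "\<And>p. p \<in> points C \<Longrightarrow> f p \<in> points C" "\<And>c. c \<in> K \<Longrightarrow> h c \<in> K"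
    "\<And>p l. (p, l) \<in> inc C \<Longrightarrow> (f p, g l) \<in> inc C" "\<And>p l. (p, l) \<in> inc C \<Longrightarrow> color (f p) (g l) = h (color p l)"
    using assms(1) unfolding config_homs_iff by blast+
  have f_shift: "f (shift a b p) = shift (h a) (h b) (f p)" if "p \<in> points C" "a \<in> K" "b \<in> K" for a b p
  proof -
    have "line (h a) (f p) = g (line a p)"
      using hom(3,4)[of p "line a p"] line[OF that(1,2)] by (intro line_eqI) auto
    moreover have "point (h b) (g (line a p)) = f (point b (line a p))"
      using hom(3,4)[of "point b (line a p)" "line a p"] point[OF line_in_lines[OF that(1,2)] that(3)] by (intro point_eqI) auto
    ultimately show ?thesis
      by (simp add: shift_def)
  qed
  obtain p a where p: "p \<in> points C" "a \<in> K" "\<sigma> \<noteq> {}" "\<sigma> \<subseteq> upper p a \<or> \<sigma> \<subseteq> lower p a"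
    using assms(2) unfolding X_def by blast
  have "f ` upper p a \<subseteq> upper (f p) (h a)" "f ` lower p a \<subseteq> lower (f p) (h a)"
    using hom(2) f_shift p(1,2) unfolding upper_def lower_def by auto
  then show ?thesis
    using p hom(1,2) by (intro X_I[of _ "f p" "h a"]) blast+
qed

abbreviation End where "End \<equiv> config_End (k + 1) C"

lemma carrier_End: "carrier End = config_homs (k + 1) C C"
  and mult_End: "(f, g, h) \<otimes>\<^bsub>End\<^esub> (f', g', h') =
    (compose (points C) f f', compose (lines C) g g', compose K h h')"
  and one_End: "\<one>\<^bsub>End\<^esub> = (\<lambda>p\<in>points C. p, \<lambda>l\<in>lines C. l, \<lambda>c\<in>K. c)"
  by (simp_all add: config_End_def)

lemma monoid_config_End: "monoid End"
proof (rule monoidI)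
  show "x \<otimes>\<^bsub>End\<^esub> y \<in> carrier End" if "x \<in> carrier End" "y \<in> carrier End" for x y
  proof -
    obtain f g h f' g' h' where xy: "x = (f, g, h)" "y = (f', g', h')"
      by (cases x, cases y)
    show ?thesis
      using that inc_points inc_lines color_in_K
      unfolding xy carrier_End mult_End config_homs_iff compose_def PiE_iff by auto
  qed
  show "\<one>\<^bsub>End\<^esub> \<in> carrier End"
    using inc_points inc_lines color_in_K unfolding carrier_End one_End config_homs_iff PiE_iff by auto
  fix x y z
  assume x: "x \<in> carrier End"
  obtain f g h where xe: "x = (f, g, h)"
    by (cases x)
  have fgh: "f \<in> points C \<rightarrow>\<^sub>E points C" "g \<in> lines C \<rightarrow>\<^sub>E lines C" "h \<in> K \<rightarrow>\<^sub>E K"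
    using x unfolding xe carrier_End config_homs_iff by blast+
  show "\<one>\<^bsub>End\<^esub> \<otimes>\<^bsub>End\<^esub> x = x"
    using fgh unfolding xe mult_End one_End by (simp add: Id_compose PiE_iff)
  show "x \<otimes>\<^bsub>End\<^esub> \<one>\<^bsub>End\<^esub> = x"
    using fgh unfolding xe mult_End one_End by (auto simp: compose_def PiE_iff extensional_def fun_eq_iff)
  assume y: "y \<in> carrier End" and z: "z \<in> carrier End"
  obtain f' g' h' f'' g'' h'' where yz: "y = (f', g', h')" "z = (f'', g'', h'')"
    by (cases y, cases z)
  have "f'' \<in> points C \<rightarrow> points C" "g'' \<in> lines C \<rightarrow> lines C" "h'' \<in> K \<rightarrow> K"
    using z unfolding yz carrier_End config_homs_iff by blast+
  then show "x \<otimes>\<^bsub>End\<^esub> y \<otimes>\<^bsub>End\<^esub> z = x \<otimes>\<^bsub>End\<^esub> (y \<otimes>\<^bsub>End\<^esub> z)"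
    unfolding xe yz mult_End by (simp add: compose_assoc)
qed

lemma fst_End:
  assumes "\<psi> \<in> carrier End"
  shows "fst \<psi> \<in> carrier (complex_End X)"
proof -
  obtain f g h where \<psi>: "\<psi> = (f, g, h)"
    by (cases \<psi>)
  then have hom: "(f, g, h) \<in> config_homs (k + 1) C C"
    using assms unfolding carrier_End by simp
  then have "f \<in> points C \<rightarrow>\<^sub>E points C"
    unfolding config_homs_iff by blast
  then show ?thesis
    using config_hom_face[OF hom] by (simp add: \<psi> complex_End_def verts_X)
qed

lemma fst_End_mult:
  "fst (\<psi> \<otimes>\<^bsub>End\<^esub> \<psi>') = fst \<psi> \<otimes>\<^bsub>complex_End X\<^esub> fst \<psi>'"
  by (simp add: config_End_def complex_End_def verts_X case_prod_unfold)

lemma fst_End_one: "fst \<one>\<^bsub>End\<^esub> = \<one>\<^bsub>complex_End X\<^esub>"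
  by (simp add: config_End_def complex_End_def verts_X)

text \<open>Taking the point map preserves products and units of the two endomorphism monoids, hence
  invertibility.\<close>

lemma fst_Units:
  assumes "\<psi> \<in> Units End"
  shows "fst \<psi> \<in> Units (complex_End X)"
proof -
  obtain \<psi>' where \<psi>: "\<psi> \<in> carrier End" "\<psi>' \<in> carrier End"
    and inv: "\<psi>' \<otimes>\<^bsub>End\<^esub> \<psi> = \<one>\<^bsub>End\<^esub>" "\<psi> \<otimes>\<^bsub>End\<^esub> \<psi>' = \<one>\<^bsub>End\<^esub>"
    using assms unfolding Units_def by blast
  have "fst \<psi>' \<otimes>\<^bsub>complex_End X\<^esub> fst \<psi> = \<one>\<^bsub>complex_End X\<^esub>"
    "fst \<psi> \<otimes>\<^bsub>complex_End X\<^esub> fst \<psi>' = \<one>\<^bsub>complex_End X\<^esub>"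
    unfolding fst_End_mult[symmetric] inv by (rule fst_End_one)+
  then show ?thesis
    unfolding Units_def using fst_End[OF \<psi>(1)] fst_End[OF \<psi>(2)] by blast
qed

text \<open>The bijection onto the vertices is the identity and point maps are extensional, so
  transport changes nothing.\<close>

lemma transported_action_eq:
  assumes "\<rho> g \<in> Units End"
  shows "transported_action C X (\<lambda>p. p) \<rho> g = fst (\<rho> g)"
proof -
  have "fst (\<rho> g) \<in> points C \<rightarrow>\<^sub>E points C"
    using fst_Units[OF assms] by (auto simp: Units_def complex_End_def verts_X)
  moreover have "inv_into (points C) (\<lambda>p. p) v = v" if "v \<in> points C" for v
    using inv_into_f_f[of "\<lambda>p. p" "points C" v] that by simp
  ultimately show ?thesis
    by (auto simp: transported_action_def verts_X PiE_iff extensional_def fun_eq_iff restrict_def)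
qed

lemma complex_action_transported:
  assumes "config_action G (k + 1) C \<rho>"
  shows "complex_action G X (transported_action C X (\<lambda>p. p) \<rho>)"
proof -
  have hom: "\<rho> \<in> hom G (config_Aut (k + 1) C)" and G: "group G"
    using assms unfolding config_action_def by auto
  have U: "\<rho> g \<in> Units End" if "g \<in> carrier G" for g
    using hom that by (auto simp: hom_def config_Aut_def units_of_def)
  have "transported_action C X (\<lambda>p. p) \<rho> \<in> hom G (complex_Aut X)"
  proof (rule homI)
    show "transported_action C X (\<lambda>p. p) \<rho> g \<in> carrier (complex_Aut X)" if "g \<in> carrier G" for g
      using transported_action_eq[of \<rho> g] U[OF that] fst_Units by (simp add: complex_Aut_def units_of_def)
    fix g g' assume g: "g \<in> carrier G" "g' \<in> carrier G"
    then have gg: "g \<otimes>\<^bsub>G\<^esub> g' \<in> carrier G"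
      using G by (simp add: group.is_monoid monoid.m_closed)
    have "\<rho> (g \<otimes>\<^bsub>G\<^esub> g') = \<rho> g \<otimes>\<^bsub>End\<^esub> \<rho> g'"
      using hom g by (simp add: hom_def config_Aut_def units_of_def)
    then show "transported_action C X (\<lambda>p. p) \<rho> (g \<otimes>\<^bsub>G\<^esub> g') =
      transported_action C X (\<lambda>p. p) \<rho> g \<otimes>\<^bsub>complex_Aut X\<^esub> transported_action C X (\<lambda>p. p) \<rho> g'"
      unfolding transported_action_eq[of \<rho>, OF U[OF gg]] transported_action_eq[of \<rho>, OF U[OF g(1)]]
        transported_action_eq[of \<rho>, OF U[OF g(2)]] complex_Aut_def units_of_mult fst_End_mult[symmetric]
      by (rule arg_cong)
  qed
  then show ?thesis
    using G unfolding complex_action_def by blast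
qed

text \<open>The tautological action, through which every other action factors. It gives the
  statement on actions for a group whose type does not depend on the type variable
  \<open>'g\<close>.\<close>

lemma config_action_Aut: "config_action (config_Aut (k + 1) C) (k + 1) C (\<lambda>\<psi>. \<psi>)"
proof -
  have "group (config_Aut (k + 1) C)"
    unfolding config_Aut_def by (rule monoid.units_group[OF monoid_config_End])
  then show ?thesis
    by (simp add: config_action_def hom_def)
qed

end

theorem theorem5p3:
  fixes C :: "('p, 'l) config" and k n :: nat
  assumes "k \<ge> 2"
    and "colored_configuration (k + 1) C"
    and "card (points C) = n" and "card (lines C) = n"
  shows "\<exists>(X :: 'p set set) \<alpha> \<Lambda>\<^sub>1 F\<^sub>1 \<beta> \<Lambda>\<^sub>2 F\<^sub>2.
     finite_complex X \<and> has_dimension X k \<and> connected (realization X) \<and>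
     (\<forall>x\<in>realization X. fundamental_group (realization X) x \<cong> int_power_group k) \<and>
     card (verts X) = n \<and>
     config_copy C X \<alpha> \<Lambda>\<^sub>1 F\<^sub>1 \<and> card F\<^sub>1 = n \<and>
     config_copy (dual C) X \<beta> \<Lambda>\<^sub>2 F\<^sub>2 \<and> card F\<^sub>2 = n \<and>
     F\<^sub>1 \<inter> F\<^sub>2 = {} \<and> F\<^sub>1 \<union> F\<^sub>2 = facets X \<and> (\<forall>\<sigma>\<in>X. \<exists>\<tau>\<in>facets X. \<sigma> \<subseteq> \<tau>) \<and>
     (\<forall>(G :: ('g, 'b) monoid_scheme) \<rho>. config_action G (k + 1) C \<rho> \<longrightarrow>
        complex_action G X (transported_action C X \<alpha> \<rho>)) \<and>
     complex_action (config_Aut (k + 1) C) X (transported_action C X \<alpha> (\<lambda>\<psi>. \<psi>)) \<and>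
     (projective_plane C \<longrightarrow> two_neighborly X)"
proof -
  interpret colored_config C k
    using assms by unfold_locales
  have card: "card (points_on ` lines C) = n" "card ((\<lambda>p. lower p 1) ` points C) = n" "card (verts X) = n"
    using assms card_image[OF inj_points_on] card_image[OF inj_lower] verts_X by simp_all
  have disjoint: "points_on ` lines C \<inter> (\<lambda>p. lower p 1) ` points C = {}"
    using points_on_neq_lower by blast
  have facet: "\<exists>\<tau>\<in>facets X. \<sigma> \<subseteq> \<tau>" if "\<sigma> \<in> X" for \<sigma>
    using face_in_facet[OF that] unfolding facets_X .
  show ?thesis
    \<comment> \<open>The vertices are the points themselves, whence the identity for the copy of
      \<open>C\<close>; for the dual, \<open>point 1\<close> selects a vertex on each line.\<close>
    by (intro exI[of _ X] exI[of _ "\<lambda>p. p"] exI[of _ points_on] exI[of _ "points_on ` lines C"]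
        exI[of _ "point 1"] exI[of _ "\<lambda>p. lower p 1"] exI[of _ "(\<lambda>p. lower p 1) ` points C"] conjI allI ballI impI)
      (rule finite_complex_X has_dimension_X connected_realization fundamental_group_realization
        config_copy_points config_copy_dual card disjoint facets_X[symmetric] facet
        complex_action_transported[OF config_action_Aut] complex_action_transported two_neighborly_X
       | assumption)+
qed

end
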